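(* For all positive integers $k,t$ with $k\ge t$ there exists $\ell_0$ such that for every $\ell\ge \ell_0$ and every profile $P=(k_1,\ldots,k_\ell)$ with $k_\ell=k$, every largest partially $t$-intersecting subfamily of $\mathcal{U}_P$ is of the form $\mathcal{C}^T_P$ for some $t$-element set $T\subset[n]$.
   Context: A profile is a non-decreasing sequence $P=(k_1,\ldots,k_\ell)$ of positive integers; $n=\sum_i k_i$. $\mathcal{U}_P$ is the family of partitions of $[n]$ into $\ell$ parts whose part sizes are $k_1,\ldots,k_\ell$. Two partitions partially $t$-intersect if some part of one and some part of the other share at least $t$ elements; a family is partially $t$-intersecting if any two members partially $t$-intersect. For a $t$-element $T\subset[n]$, $\mathcal{C}^T_P$ consists of all partitions in $\mathcal{U}_P$ having a part that fully contains $T$. *)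

theory Defs
  imports "HOL-Library.Multiset" "HOL-Library.Disjoint_Sets"
begin

definition profile :: "nat list \<Rightarrow> bool" where
  "profile P \<longleftrightarrow> sorted P \<and> (\<forall>k\<in>set P. 0 < k)"

text \<open>Partitions are unordered. Since parts of equal size are allowed, the part sizes are
  compared with the profile as multisets; this also forces the number of parts to be
  \<^term>\<open>length P\<close>. The ground set is $\{1,\dots,n\}$ with $n$ the sum of the profile.\<close>

definition profile_partitions :: "nat list \<Rightarrow> nat set set set" where
  "profile_partitions P =
     {U. partition_on {1..sum_list P} U \<and> image_mset card (mset_set U) = mset P}"

definition partially_intersect :: "nat \<Rightarrow> nat set set \<Rightarrow> nat set set \<Rightarrow> bool" where
  "partially_intersect t U V \<longleftrightarrow> (\<exists>A\<in>U. \<exists>B\<in>V. t \<le> card (A \<inter> B))"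

definition partially_intersecting :: "nat \<Rightarrow> nat set set set \<Rightarrow> bool" where
  "partially_intersecting t F \<longleftrightarrow> (\<forall>U\<in>F. \<forall>V\<in>F. partially_intersect t U V)"

definition largest_partially_intersecting :: "nat \<Rightarrow> nat list \<Rightarrow> nat set set set \<Rightarrow> bool" where
  "largest_partially_intersecting t P F \<longleftrightarrow>
     F \<subseteq> profile_partitions P \<and> partially_intersecting t F \<and>
     (\<forall>G. G \<subseteq> profile_partitions P \<and> partially_intersecting t G \<longrightarrow> card G \<le> card F)"

definition canonical_family :: "nat list \<Rightarrow> nat set \<Rightarrow> nat set set set" where
  "canonical_family P T = {U \<in> profile_partitions P. \<exists>A\<in>U. T \<subseteq> A}"

end

theory Submission
  imports Defs Complex_Main "HOL-Combinatorics.Transposition"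
begin

text \<open>Encode a partition by the ordered pairs of distinct points lying in a common part. For
  \<open>t = 1\<close> any two partitions intersect, so let \<open>t \<ge> 2\<close>, let \<open>k\<close> be the largest part size, \<open>n\<close> the
  size of the ground set, and \<open>r\<close> a small fixed power of \<open>n\<close>. If \<open>X\<close> is an
  inclusion-maximal set of pairs contained in at least a fraction \<open>r ^ (- card X)\<close> of a nonempty
  subfamily of \<open>F\<close>, then the members of this subfamily containing \<open>X\<close> are \<open>r\<close>-spread above \<open>X\<close>. Call such an \<open>X\<close> of bounded size a core. All
  but a \<open>n ^ (- t - 1)\<close> fraction of all partitions in \<open>F\<close> contain a core, because prescribing \<open>m\<close>
  pairs has probability at most \<open>(2 * k / n) ^ (m div (4 * k))\<close>.

  Two spread families always contain members with no common pair outside their cores: colour all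
  pairs at random; by the minimal-fragment argument of Park and Pham, each family has, with
  probability above \<open>1 / 2\<close>, a member using only its own half of the colours. Hence any two cores contain a common
  \<open>t\<close>-set. As cores have bounded size, either there is no \<open>t\<close>-set common to all of them, and then
  \<open>F\<close> is covered by boundedly many intersections of two stars, each smaller than a star by a
  factor of order \<open>n\<close>; or all cores share a \<open>t\<close>-set \<open>T\<close>. In the latter case a member of \<open>F\<close> outside
  the star of \<open>T\<close> would, by a switching argument, exclude a constant fraction of that star.\<close>

section \<open>Spread families\<close>

lemma sum_Pow_power_card:
  fixes x :: "'b::comm_ring_1"
  assumes "finite A"
  shows "(\<Sum>X\<in>Pow A. x ^ card X) = (1 + x) ^ card A"
  using prod_add[OF assms, of "\<lambda>_. x" "\<lambda>_. 1"] by (simp add: add.commute)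

text \<open>Inserting the weight \<open>b ^ (card X - Suc u)\<close> turns the tail into the full binomial sum.\<close>

lemma sum_large_subsets_le:
  fixes b :: real
  assumes "finite D" "card D \<le> s" "3 \<le> b" "real s \<le> b * (real u + 1)"
  shows "(\<Sum>X | X \<subseteq> D \<and> u < card X. (1 / b\<^sup>2) ^ card X) \<le> 3 / b"
proof -
  have b: "b > 0" using assms(3) by simp
  have pw: "(1 / b\<^sup>2) ^ card X \<le> (1 / b) ^ card X / b ^ Suc u" if "u < card X" for X :: "'a set"
  proof -
    have "b ^ Suc u \<le> b ^ card X"
      using that assms(3) by (intro power_increasing) auto
    then have "1 / b ^ card X \<le> 1 / b ^ Suc u"
      using b by (intro divide_left_mono) auto
    then have "(1 / b ^ card X) * (1 / b ^ card X) \<le> (1 / b ^ card X) * (1 / b ^ Suc u)"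
      using b by (intro mult_left_mono) auto
    moreover have "(b\<^sup>2) ^ card X = b ^ card X * b ^ card X"
      by (simp add: power2_eq_square power_mult_distrib)
    ultimately show ?thesis using b by (simp add: power_one_over divide_simps)
  qed
  have "(\<Sum>X | X \<subseteq> D \<and> u < card X. (1 / b\<^sup>2) ^ card X)
      \<le> (\<Sum>X | X \<subseteq> D \<and> u < card X. (1 / b) ^ card X / b ^ Suc u)"
    using pw by (intro sum_mono) auto
  also have "\<dots> \<le> (\<Sum>X\<in>Pow D. (1 / b) ^ card X / b ^ Suc u)"
    using assms(1) b by (intro sum_mono2) auto
  also have "\<dots> = (1 + 1 / b) ^ card D / b ^ Suc u"
    using sum_Pow_power_card[OF assms(1), of "1 / b"] by (simp flip: sum_divide_distrib)
  also have "(1 + 1 / b) ^ card D \<le> exp (real u + 1)"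
  proof -
    have "(1 + 1 / b) ^ card D \<le> exp (1 / b) ^ card D"
      using b by (intro power_mono exp_ge_add_one_self) auto
    also have "\<dots> = exp (real (card D) / b)" by (simp flip: exp_of_nat_mult)
    also have "real (card D) / b \<le> real u + 1"
      using assms(2,4) b by (simp add: divide_simps mult.commute)
    finally show ?thesis by simp
  qed
  also have "exp (real u + 1) / b ^ Suc u = (exp 1 / b) ^ Suc u"
    using exp_of_nat_mult[of "Suc u" "1::real"] by (simp add: power_divide add.commute)
  also have "\<dots> \<le> (3 / b) ^ Suc u"
    using b exp_le by (intro power_mono divide_right_mono) auto
  also have "\<dots> \<le> (3 / b) ^ 1"
    using b assms(3) by (intro power_decreasing) auto
  finally show ?thesis using b by (simp add: divide_right_mono)
qed

text \<open>The enumeration \<open>c\<close> of the colours is a parameter so that one argument can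
  run on two disjoint palettes; \<open>j\<close> of its colours have been released so far.\<close>

definition colour_class :: "'a set \<Rightarrow> (nat \<Rightarrow> nat) \<Rightarrow> ('a \<Rightarrow> nat) \<Rightarrow> nat \<Rightarrow> 'a set" where
  "colour_class \<Omega> c f j = {x\<in>\<Omega>. f x \<in> c ` {..<j}}"

text \<open>Indexing by \<open>I\<close> keeps multiplicities, so a family of partitions can be its
  own index set, with \<open>S\<close> a set of pairs derived from each.\<close>

locale spread_family =
  fixes \<Omega> :: "'a set" and I :: "'i set" and S :: "'i \<Rightarrow> 'a set" and R :: real
  assumes fin_ground: "finite \<Omega>" and fin_index: "finite I" and ne_index: "I \<noteq> {}"
    and sub_ground: "i \<in> I \<Longrightarrow> S i \<subseteq> \<Omega>"
    and R_pos: "0 < R"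
    and spread: "Y \<subseteq> \<Omega> \<Longrightarrow> real (card {i\<in>I. Y \<subseteq> S i}) * R ^ card Y \<le> real (card I)"
begin

text \<open>Keeping the remainder of \<open>i'\<close> inside \<open>S i\<close> is what lets
  spreadness count the indices \<open>i\<close>. Once \<open>s j = 0\<close>, some member is fully
  covered.\<close>

definition nearly_covers :: "(nat \<Rightarrow> nat) \<Rightarrow> (nat \<Rightarrow> nat) \<Rightarrow> ('a \<Rightarrow> nat) \<Rightarrow> 'i \<Rightarrow> nat \<Rightarrow> bool" where
  "nearly_covers c s f i j \<longleftrightarrow>
     (\<exists>i'\<in>I. card (S i' - colour_class \<Omega> c f j) \<le> s j \<and> S i' - colour_class \<Omega> c f j \<subseteq> S i)"

text \<open>Minimal-fragment argument of Park and Pham: recolouring the smallest uncovered fragment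
  \<open>\<chi>\<close> with the new colour gives a colouring \<open>f'\<close>, and by minimality \<open>\<chi>\<close> lies in every small
  uncovered set which \<open>f'\<close> covers. Hence \<open>\<chi>\<close> is one of few subsets determined by \<open>f'\<close>, while
  spreadness bounds the number of \<open>i\<close> with \<open>\<chi> \<subseteq> S i\<close>.\<close>

lemma stage_failures:
  fixes b :: real
  assumes inj: "inj_on c {..<h}" and col: "\<And>j. j < h \<Longrightarrow> c j < q" and jh: "j < h"
    and b: "3 \<le> b" and qR: "real q * b\<^sup>2 \<le> R"
    and s: "real (s j) \<le> b * (real (s (Suc j)) + 1)"
  shows "real (card {(f, i). f \<in> \<Omega> \<rightarrow>\<^sub>E {..<q} \<and> i \<in> I \<and>
             nearly_covers c s f i j \<and> \<not> nearly_covers c s f i (Suc j)})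
         \<le> 3 / b * real q ^ card \<Omega> * real (card I)"
proof -
  let ?W = "colour_class \<Omega> c"
  let ?u = "s (Suc j)"
  let ?Fun = "\<Omega> \<rightarrow>\<^sub>E {..<q}"
  let ?Bad = "{(f, i). f \<in> ?Fun \<and> i \<in> I \<and> nearly_covers c s f i j \<and> \<not> nearly_covers c s f i (Suc j)}"
  \<comment> \<open>Size is measured before the new colour and containment after it: recolouring
    with \<open>c j\<close> leaves \<open>?W f j\<close> unchanged, so the size condition can be
    read off the recoloured colouring.\<close>
  define cand where "cand f i i' \<longleftrightarrow>
    i' \<in> I \<and> card (S i' - ?W f j) \<le> s j \<and> S i' - ?W f (Suc j) \<subseteq> S i" for f i i'
  define best where "best f i = arg_min (\<lambda>i'. card (S i' - ?W f (Suc j))) (cand f i)" for f i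
  define \<chi> where "\<chi> f i = S (best f i) - ?W f (Suc j)" for f i
  define rec where "rec f i = (\<lambda>x. if x \<in> \<chi> f i then c j else f x)" for f i
  \<comment> \<open>\<open>pick\<close> and \<open>D\<close> depend on \<open>g\<close> alone, so
    the fragment becomes a subset of a set known from the recoloured colouring. The default
    \<open>{}\<close> keeps \<open>card (D g) \<le> s j\<close> for every \<open>g\<close>.\<close>
  define pick where "pick g = (SOME i'. i' \<in> I \<and> card (S i' - ?W g j) \<le> s j \<and> S i' \<subseteq> ?W g (Suc j))" for g
  define D where "D g = (if \<exists>i'. i' \<in> I \<and> card (S i' - ?W g j) \<le> s j \<and> S i' \<subseteq> ?W g (Suc j)
                         then S (pick g) - ?W g j else {})" for g
  have cj: "c j \<notin> c ` {..<j}"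
    using inj jh by (auto dest: inj_onD)
  have Wmono: "?W f j \<subseteq> ?W f (Suc j)" for f by (auto simp: colour_class_def)
  have fS: "finite (S i)" if "i \<in> I" for i using that sub_ground fin_ground finite_subset by blast
  have pickP: "pick g \<in> I \<and> card (S (pick g) - ?W g j) \<le> s j \<and> S (pick g) \<subseteq> ?W g (Suc j)"
    if "\<exists>i'. i' \<in> I \<and> card (S i' - ?W g j) \<le> s j \<and> S i' \<subseteq> ?W g (Suc j)" for g
    unfolding pick_def by (rule someI_ex) (rule that)
  have D: "finite (D g)" "card (D g) \<le> s j" "D g \<subseteq> \<Omega>" for g
    using pickP[of g] fS sub_ground by (auto simp: D_def)
  have bad: "\<chi> f i \<subseteq> D (rec f i) \<and> ?u < card (\<chi> f i) \<and> \<chi> f i \<subseteq> S i \<and> \<chi> f i \<subseteq> \<Omega> \<and> rec f i \<in> ?Fun"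
    if fi: "(f, i) \<in> ?Bad" for f i
  proof -
    have f: "f \<in> ?Fun" and i: "i \<in> I" and g: "nearly_covers c s f i j"
      and ng: "\<not> nearly_covers c s f i (Suc j)" using fi by auto
    obtain i0 where "cand f i i0"
      using g Wmono[of f] unfolding nearly_covers_def cand_def by blast
    then have best: "cand f i (best f i)"
      and min: "\<And>i'. cand f i i' \<Longrightarrow> card (\<chi> f i) \<le> card (S i' - ?W f (Suc j))"
      unfolding best_def \<chi>_def by (auto intro: arg_min_natI arg_min_nat_le)
    have bI: "best f i \<in> I" and bs: "card (S (best f i) - ?W f j) \<le> s j" and sub: "\<chi> f i \<subseteq> S i"
      using best by (auto simp: cand_def \<chi>_def)
    have "?u < card (\<chi> f i)"
      using ng bI sub unfolding nearly_covers_def \<chi>_def by (meson not_le)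
    have chO: "\<chi> f i \<subseteq> \<Omega>" using bI sub_ground by (auto simp: \<chi>_def)
    have rF: "rec f i \<in> ?Fun"
      using f chO col[OF jh] unfolding rec_def by (auto simp: PiE_iff extensional_def)
    have Wj: "?W (rec f i) j = ?W f j"
      using cj Wmono[of f] by (auto simp: colour_class_def rec_def \<chi>_def)
    have WSj: "?W (rec f i) (Suc j) = ?W f (Suc j) \<union> \<chi> f i"
      using chO by (auto simp: colour_class_def rec_def)
    have ex: "\<exists>i'. i' \<in> I \<and> card (S i' - ?W (rec f i) j) \<le> s j \<and> S i' \<subseteq> ?W (rec f i) (Suc j)"
      using bI bs unfolding Wj WSj \<chi>_def by blast
    let ?p = "pick (rec f i)"
    have p: "?p \<in> I" "card (S ?p - ?W f j) \<le> s j" "S ?p \<subseteq> ?W f (Suc j) \<union> \<chi> f i"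
      using pickP[OF ex] unfolding Wj WSj by auto
    have ps: "S ?p - ?W f (Suc j) \<subseteq> \<chi> f i" using p(3) by auto
    then have "cand f i ?p" using p sub by (auto simp: cand_def)
    from min[OF this] have "S ?p - ?W f (Suc j) = \<chi> f i"
      using ps fS[OF bI] by (intro card_subset_eq) (auto simp: \<chi>_def intro: card_mono antisym)
    then have "\<chi> f i \<subseteq> D (rec f i)"
      using ex Wmono[of f] unfolding D_def Wj by auto
    with \<open>?u < card (\<chi> f i)\<close> sub chO rF show ?thesis by blast
  qed
  define Tgt where "Tgt = (SIGMA g:?Fun. SIGMA X:{X. X \<subseteq> D g \<and> ?u < card X}.
      (X \<rightarrow>\<^sub>E {..<q}) \<times> {i\<in>I. X \<subseteq> S i})"
  have finFun: "finite ?Fun" using fin_ground by (intro finite_PiE) auto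
  have finX: "finite {X. X \<subseteq> D g \<and> ?u < card X}" for g
    using D(1)[of g] by auto
  have finP: "finite ((X \<rightarrow>\<^sub>E {..<q}) \<times> {i\<in>I. X \<subseteq> S i})" if "X \<subseteq> D g" for X g
    using D(1)[of g] that fin_index by (intro finite_cartesian_product finite_PiE) (auto intro: finite_subset)
  define Tg where "Tg = (\<lambda>g. SIGMA X:{X. X \<subseteq> D g \<and> ?u < card X}. (X \<rightarrow>\<^sub>E {..<q}) \<times> {i\<in>I. X \<subseteq> S i})"
  have finTg: "finite (Tg g)" for g
    unfolding Tg_def by (rule finite_SigmaI[OF finX], rule finP) auto
  have Tgt: "Tgt = Sigma ?Fun Tg" by (simp only: Tgt_def Tg_def)
  have finT: "finite Tgt"
    unfolding Tgt by (rule finite_SigmaI[OF finFun finTg])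
  have cTg: "card (Tg g) = (\<Sum>X | X \<subseteq> D g \<and> ?u < card X.
        card ((X \<rightarrow>\<^sub>E {..<q}) \<times> {i\<in>I. X \<subseteq> S i}))" for g
    unfolding Tg_def by (rule card_SigmaI[OF finX]) (use finP in blast)
  \<comment> \<open>Storing the overwritten colours makes the encoding injective. A fragment
    \<open>X\<close> costs \<open>q ^ card X\<close> colourings while spreadness saves
    \<open>R ^ card X\<close>, a net factor of at most
    \<open>(1 / b\<^sup>2) ^ card X\<close>.\<close>
  define \<Phi> where "\<Phi> = (\<lambda>(f, i). (rec f i, \<chi> f i, restrict f (\<chi> f i), i))"
  have im: "\<Phi> ` ?Bad \<subseteq> Tgt"
  proof (rule image_subsetI)
    fix p assume p: "p \<in> ?Bad"
    obtain f i where pfi: "p = (f, i)" by (cases p)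
    have "restrict f (\<chi> f i) \<in> \<chi> f i \<rightarrow>\<^sub>E {..<q}"
      using bad[of f i] p pfi by (auto simp: PiE_iff Pi_iff subset_iff)
    then show "\<Phi> p \<in> Tgt" using bad[of f i] p pfi by (auto simp: \<Phi>_def Tgt_def)
  qed
  have "inj_on \<Phi> ?Bad"
  proof (rule inj_onI)
    fix p p' assume "p \<in> ?Bad" "p' \<in> ?Bad" and e: "\<Phi> p = \<Phi> p'"
    obtain f i f' i' where pp: "p = (f, i)" "p' = (f', i')" by (cases p, cases p') auto
    have e': "rec f i = rec f' i'" "\<chi> f i = \<chi> f' i'" "restrict f (\<chi> f i) = restrict f' (\<chi> f' i')" "i = i'"
      using e pp by (auto simp: \<Phi>_def)
    have "f x = f' x" for x
      using fun_cong[OF e'(1), of x] fun_cong[OF e'(3), of x] e'(2) by (auto simp: rec_def split: if_splits)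
    then show "p = p'" using pp e' by auto
  qed
  then have "card ?Bad \<le> card Tgt" using im finT by (rule card_inj_on_le)
  also have "card Tgt = (\<Sum>g\<in>?Fun. \<Sum>X | X \<subseteq> D g \<and> ?u < card X.
        card ((X \<rightarrow>\<^sub>E {..<q}) \<times> {i\<in>I. X \<subseteq> S i}))"
    unfolding Tgt by (subst card_SigmaI[OF finFun]) (simp_all add: finTg cTg)
  finally have "real (card ?Bad) \<le> (\<Sum>g\<in>?Fun. \<Sum>X | X \<subseteq> D g \<and> ?u < card X.
        real (card ((X \<rightarrow>\<^sub>E {..<q}) \<times> {i\<in>I. X \<subseteq> S i})))"
    by (simp flip: of_nat_sum)
  also have "\<dots> \<le> (\<Sum>g\<in>?Fun. \<Sum>X | X \<subseteq> D g \<and> ?u < card X. (1 / b\<^sup>2) ^ card X * real (card I))"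
  proof (intro sum_mono)
    fix g X assume X: "X \<in> {X. X \<subseteq> D g \<and> ?u < card X}"
    then have XO: "X \<subseteq> \<Omega>" and fX: "finite X" using D(1,3)[of g] by (auto intro: finite_subset)
    have cI: "real (card {i\<in>I. X \<subseteq> S i}) \<le> real (card I) / R ^ card X"
      using spread[OF XO] R_pos by (simp add: field_simps)
    have "real (card ((X \<rightarrow>\<^sub>E {..<q}) \<times> {i\<in>I. X \<subseteq> S i})) = real q ^ card X * real (card {i\<in>I. X \<subseteq> S i})"
      using fX by (simp add: card_cartesian_product card_PiE)
    also have "\<dots> \<le> real q ^ card X * (real (card I) / R ^ card X)"
      using cI by (intro mult_left_mono) auto
    also have "\<dots> = (real q / R) ^ card X * real (card I)" by (simp add: power_divide)
    also have "real q / R \<le> 1 / b\<^sup>2" using qR b R_pos by (simp add: field_simps)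
    then have "(real q / R) ^ card X * real (card I) \<le> (1 / b\<^sup>2) ^ card X * real (card I)"
      using R_pos by (intro mult_right_mono power_mono) auto
    finally show "real (card ((X \<rightarrow>\<^sub>E {..<q}) \<times> {i\<in>I. X \<subseteq> S i})) \<le> (1 / b\<^sup>2) ^ card X * real (card I)" .
  qed
  also have "\<dots> = (\<Sum>g\<in>?Fun. (\<Sum>X | X \<subseteq> D g \<and> ?u < card X. (1 / b\<^sup>2) ^ card X) * real (card I))"
    by (simp add: sum_distrib_right)
  also have "\<dots> \<le> (\<Sum>g\<in>?Fun. 3 / b * real (card I))"
    using sum_large_subsets_le[OF D(1,2) b s] by (intro sum_mono mult_right_mono) auto
  also have "\<dots> = 3 / b * real q ^ card \<Omega> * real (card I)"
    using fin_ground by (simp add: card_PiE)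
  finally show ?thesis .
qed

text \<open>The thresholds \<open>s\<close> fall by a factor \<open>b\<close> per stage, from the
  largest member size to \<open>0\<close> after \<open>h\<close> stages. A colouring that covers no
  member drops out at some stage for every index; each stage loses at most a fraction
  \<open>3 / b\<close> of all pairs, and \<open>3 * h / b < 1 / 2\<close>.\<close>

lemma uncovered_colourings:
  fixes b :: real
  assumes inj: "inj_on c {..<h}" and col: "\<And>j. j < h \<Longrightarrow> c j < q"
    and b: "6 * real h < b" "3 \<le> b" and qR: "real q * b\<^sup>2 \<le> R" and q: "0 < q"
    and size: "\<And>i. i \<in> I \<Longrightarrow> real (card (S i)) < b ^ h"
  shows "2 * card {f \<in> \<Omega> \<rightarrow>\<^sub>E {..<q}. \<not> (\<exists>i\<in>I. S i \<subseteq> colour_class \<Omega> c f h)} < q ^ card \<Omega>"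
proof -
  let ?Fun = "\<Omega> \<rightarrow>\<^sub>E {..<q}"
  define m where "m = Max ((\<lambda>i. card (S i)) ` I)"
  have m: "card (S i) \<le> m" if "i \<in> I" for i
    unfolding m_def using that fin_index by (intro Max_ge) auto
  have "m \<in> (\<lambda>i. card (S i)) ` I" unfolding m_def using fin_index ne_index by (intro Max_in) auto
  then have mh: "real m < b ^ h" using size by auto
  define s where "s j = nat \<lfloor>real m / b ^ j\<rfloor>" for j
  have b0: "b > 0" using b by simp
  have sj: "real (s j) \<le> real m / b ^ j" "real m / b ^ j < real (s j) + 1" for j
    using b0 by (simp_all add: s_def)
  have s_step: "real (s j) \<le> b * (real (s (Suc j)) + 1)" for j
  proof -
    have "real (s j) \<le> b * (real m / b ^ Suc j)" using sj(1)[of j] b0 by simp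
    also have "\<dots> \<le> b * (real (s (Suc j)) + 1)"
      using sj(2)[of "Suc j"] b0 by (intro mult_left_mono) auto
    finally show ?thesis .
  qed
  have s0: "s 0 = m" by (simp add: s_def)
  have sh: "s h = 0" using mh b0 by (simp add: s_def floor_eq_iff)
  let ?Bad = "\<lambda>j. {(f, i). f \<in> ?Fun \<and> i \<in> I \<and> nearly_covers c s f i j \<and> \<not> nearly_covers c s f i (Suc j)}"
  have finFun: "finite ?Fun" using fin_ground by (intro finite_PiE) auto
  have finBad: "finite (?Bad j)" for j
    by (rule finite_subset[of _ "?Fun \<times> I"]) (use finFun fin_index in auto)
  let ?N = "{f \<in> ?Fun. \<not> (\<exists>i\<in>I. S i \<subseteq> colour_class \<Omega> c f h)}"
  have "?N \<times> I \<subseteq> (\<Union>j<h. ?Bad j)"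
  proof clarify
    fix f i assume f: "f \<in> ?Fun" and n: "\<not> (\<exists>i\<in>I. S i \<subseteq> colour_class \<Omega> c f h)" and i: "i \<in> I"
    have g0: "nearly_covers c s f i 0"
      unfolding nearly_covers_def using i m s0 by (auto simp: colour_class_def)
    have gh: "\<not> nearly_covers c s f i h"
    proof
      assume "nearly_covers c s f i h"
      then obtain i' where "i' \<in> I" "card (S i' - colour_class \<Omega> c f h) = 0"
        unfolding nearly_covers_def sh by auto
      moreover have "finite (S i')" using \<open>i' \<in> I\<close> sub_ground fin_ground finite_subset by blast
      ultimately show False using n by auto
    qed
    have "\<exists>j<h. nearly_covers c s f i j \<and> \<not> nearly_covers c s f i (Suc j)"
    proof (rule ccontr)
      assume a: "\<not> ?thesis"
      have "j \<le> h \<Longrightarrow> nearly_covers c s f i j" for j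
        by (induction j) (use g0 a in auto)
      then show False using gh by auto
    qed
    then show "(f, i) \<in> (\<Union>j<h. ?Bad j)" using f i by auto
  qed
  then have "card (?N \<times> I) \<le> card (\<Union>j<h. ?Bad j)"
    using finBad by (intro card_mono) auto
  also have "\<dots> \<le> (\<Sum>j<h. card (?Bad j))" by (rule card_UN_le) simp
  finally have "real (card ?N) * real (card I) \<le> (\<Sum>j<h. real (card (?Bad j)))"
    by (simp add: card_cartesian_product flip: of_nat_sum of_nat_mult)
  also have "\<dots> \<le> (\<Sum>j<h. 3 / b * real q ^ card \<Omega> * real (card I))"
    using stage_failures[where s = s and c = c and q = q, OF inj col _ b(2) qR s_step]
    by (intro sum_mono) auto
  also have "\<dots> = (real h * 3 / b * real q ^ card \<Omega>) * real (card I)" by simp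
  finally have "real (card ?N) * real (card I) \<le> (real h * 3 / b * real q ^ card \<Omega>) * real (card I)" .
  moreover have "0 < real (card I)" using fin_index ne_index by (simp add: card_gt_0_iff)
  ultimately have "real (card ?N) \<le> real h * 3 / b * real q ^ card \<Omega>"
    by (rule mult_right_le_imp_le)
  also have "\<dots> < 1 / 2 * real q ^ card \<Omega>"
    using b b0 q by (intro mult_strict_right_mono) (auto simp: field_simps)
  finally have "real (2 * card ?N) < real (q ^ card \<Omega>)" by simp
  then show ?thesis unfolding of_nat_less_iff .
qed

end

text \<open>Of \<open>2 * h\<close> colours the first \<open>h\<close> go to one family and the last
  \<open>h\<close> to the other. Each family fails on fewer than half of the colourings, so some
  colouring serves both.\<close>

lemma spread_families_disjoint_members:
  fixes b :: real
  assumes "spread_family \<Omega> I S R" "spread_family \<Omega> I' S' R"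
    and b: "6 * real h < b" "3 \<le> b" and h: "0 < h" and R: "2 * real h * b\<^sup>2 \<le> R"
    and size: "\<And>i. i \<in> I \<Longrightarrow> real (card (S i)) < b ^ h"
    and size': "\<And>i. i \<in> I' \<Longrightarrow> real (card (S' i)) < b ^ h"
  shows "\<exists>i\<in>I. \<exists>i'\<in>I'. S i \<inter> S' i' = {}"
proof -
  interpret A: spread_family \<Omega> I S R by fact
  interpret B: spread_family \<Omega> I' S' R by fact
  let ?Fun = "\<Omega> \<rightarrow>\<^sub>E {..<2 * h}"
  let ?c = "\<lambda>j. h + j"
  let ?N = "{f \<in> ?Fun. \<not> (\<exists>i\<in>I. S i \<subseteq> colour_class \<Omega> id f h)}"
  let ?N' = "{f \<in> ?Fun. \<not> (\<exists>i\<in>I'. S' i \<subseteq> colour_class \<Omega> ?c f h)}"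
  have "2 * card ?N < (2 * h) ^ card \<Omega>"
    by (rule A.uncovered_colourings[OF _ _ b]) (use R h size in auto)
  moreover have "2 * card ?N' < (2 * h) ^ card \<Omega>"
    by (rule B.uncovered_colourings[OF _ _ b]) (use R h size' in auto)
  moreover have "card ?Fun = (2 * h) ^ card \<Omega>" using A.fin_ground by (simp add: card_PiE)
  moreover have "card (?N \<union> ?N') \<le> card ?N + card ?N'" by (rule card_Un_le)
  ultimately have "card (?N \<union> ?N') < card ?Fun" by linarith
  then have "?N \<union> ?N' \<noteq> ?Fun" by auto
  then obtain f where "f \<in> ?Fun" "f \<notin> ?N" "f \<notin> ?N'" by auto
  then obtain i i' where "i \<in> I" "i' \<in> I'" "S i \<subseteq> colour_class \<Omega> id f h" "S' i' \<subseteq> colour_class \<Omega> ?c f h"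
    by auto
  moreover have "colour_class \<Omega> id f h \<inter> colour_class \<Omega> ?c f h = {}"
    by (auto simp: colour_class_def)
  ultimately show ?thesis by blast
qed

section \<open>Families of partitions closed under transpositions\<close>

text \<open>Diagonal pairs are left out because they occur in every partition and would ruin
  spreadness.\<close>

definition part_pairs :: "'a set set \<Rightarrow> ('a \<times> 'a) set" where
  "part_pairs U = {(x, y). x \<noteq> y \<and> (\<exists>A\<in>U. x \<in> A \<and> y \<in> A)}"

definition swap_points :: "'a \<Rightarrow> 'a \<Rightarrow> 'a set set \<Rightarrow> 'a set set" where
  "swap_points a b U = (`) (transpose a b) ` U"

lemma part_pairs_swap_points:
  "(x, y) \<in> part_pairs (swap_points a b U) \<longleftrightarrow> (transpose a b x, transpose a b y) \<in> part_pairs U"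
proof -
  have "z \<in> transpose a b ` A \<longleftrightarrow> transpose a b z \<in> A" for z A
    by (metis imageE imageI transpose_involutory)
  moreover have "transpose a b x = transpose a b y \<longleftrightarrow> x = y"
    by (metis transpose_involutory)
  ultimately show ?thesis by (auto simp: part_pairs_def swap_points_def)
qed

lemma swap_points_involutory: "swap_points a b (swap_points a b U) = U"
  by (simp add: swap_points_def image_image)

lemma part_pairs_sym: "(x, y) \<in> part_pairs U \<Longrightarrow> (y, x) \<in> part_pairs U"
  by (auto simp: part_pairs_def)

lemma part_pairs_irrefl: "(x, y) \<in> part_pairs U \<Longrightarrow> x \<noteq> y"
  by (auto simp: part_pairs_def)

lemma offdiag_subset_part_pairs_iff:
  assumes "partition_on V U" "T \<subseteq> V" "T \<noteq> {}"
  shows "T \<times> T - Id \<subseteq> part_pairs U \<longleftrightarrow> (\<exists>A\<in>U. T \<subseteq> A)"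
proof
  assume sub: "T \<times> T - Id \<subseteq> part_pairs U"
  obtain x where x: "x \<in> T" using assms(3) by auto
  then obtain A where A: "A \<in> U" "x \<in> A" using assms(1,2) partition_onD1 by blast
  have "y \<in> A" if y: "y \<in> T" for y
  proof (cases "y = x")
    case False
    then have "(x, y) \<in> part_pairs U" using x y sub by auto
    then obtain B where "B \<in> U" "x \<in> B" "y \<in> B" by (auto simp: part_pairs_def)
    then show ?thesis using A partition_onD2[OF assms(1)] by (auto simp: disjoint_def)
  qed (use A in simp)
  then show "\<exists>A\<in>U. T \<subseteq> A" using A by auto
qed (auto simp: part_pairs_def)

text \<open>What the switching arguments need from a profile: parts of size at most
  \<open>k\<close>, and closure under swapping two points.\<close>

locale partition_family =
  fixes V :: "'a set" and k :: nat and UU :: "'a set set set"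
  assumes fin_ground: "finite V" and k_pos: "0 < k"
    and partition: "U \<in> UU \<Longrightarrow> partition_on V U"
    and part_card: "U \<in> UU \<Longrightarrow> A \<in> U \<Longrightarrow> card A \<le> k"
    and swap_closed: "U \<in> UU \<Longrightarrow> x \<in> V \<Longrightarrow> y \<in> V \<Longrightarrow> swap_points x y U \<in> UU"
begin

definition containing :: "('a \<times> 'a) set \<Rightarrow> 'a set set set" where
  "containing X = {U\<in>UU. X \<subseteq> part_pairs U}"

lemma containing_subset: "containing X \<subseteq> UU"
  by (auto simp: containing_def)

lemma finite_family: "finite UU"
proof (rule finite_subset)
  show "UU \<subseteq> Pow (Pow V)" using partition partition_onD1 by blast
qed (simp add: fin_ground)

lemma part_pairs_subset: "U \<in> UU \<Longrightarrow> part_pairs U \<subseteq> V \<times> V"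
  using partition partition_onD1 by (fastforce simp: part_pairs_def)

lemma finite_part_pairs: "U \<in> UU \<Longrightarrow> finite (part_pairs U)"
  using part_pairs_subset fin_ground finite_subset by blast

lemma finite_neighbours: "U \<in> UU \<Longrightarrow> finite {y. (x, y) \<in> part_pairs U}"
  by (rule finite_subset[OF _ fin_ground]) (use part_pairs_subset in auto)

lemma card_neighbours_le:
  assumes U: "U \<in> UU"
  shows "card {y. (x, y) \<in> part_pairs U} \<le> k"
proof (cases "{y. (x, y) \<in> part_pairs U} = {}")
  case False
  then obtain A where A: "A \<in> U" "x \<in> A" by (auto simp: part_pairs_def)
  have "A \<subseteq> V" using A U partition partition_onD1 by blast
  moreover have "{y. (x, y) \<in> part_pairs U} \<subseteq> A"
    using A partition_onD2[OF partition[OF U]] by (auto simp: part_pairs_def disjoint_def)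
  ultimately have "card {y. (x, y) \<in> part_pairs U} \<le> card A"
    using fin_ground by (intro card_mono) (auto intro: finite_subset)
  also have "\<dots> \<le> k" using part_card[OF U A(1)] .
  finally show ?thesis .
qed (metis card.empty le0)

lemma card_second_neighbours_le:
  assumes "U \<in> UU" "U' \<in> UU"
  shows "card {z. \<exists>w. (b, w) \<in> part_pairs U \<and> (w, z) \<in> part_pairs U'} \<le> k * k"
proof -
  have "card (\<Union>w\<in>{w. (b, w) \<in> part_pairs U}. {z. (w, z) \<in> part_pairs U'})
      \<le> (\<Sum>w\<in>{w. (b, w) \<in> part_pairs U}. card {z. (w, z) \<in> part_pairs U'})"
    using finite_neighbours assms by (intro card_UN_le) auto
  also have "\<dots> \<le> (\<Sum>w\<in>{w. (b, w) \<in> part_pairs U}. k)"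
    using card_neighbours_le assms by (intro sum_mono) auto
  also have "\<dots> \<le> k * k" using card_neighbours_le[OF assms(1)] by simp
  also have "(\<Union>w\<in>{w. (b, w) \<in> part_pairs U}. {z. (w, z) \<in> part_pairs U'})
      = {z. \<exists>w. (b, w) \<in> part_pairs U \<and> (w, z) \<in> part_pairs U'}" by auto
  finally show ?thesis .
qed

lemma card_pairs_from_le:
  assumes U: "U \<in> UU" and X: "X \<subseteq> part_pairs U" and Q: "finite Q"
  shows "card {p\<in>X. fst p \<in> Q} \<le> k * card Q"
proof -
  have "{p\<in>X. fst p \<in> Q} \<subseteq> (SIGMA x:Q. {y. (x, y) \<in> part_pairs U})"
    using X by auto
  then have "card {p\<in>X. fst p \<in> Q} \<le> card (SIGMA x:Q. {y. (x, y) \<in> part_pairs U})"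
    using Q finite_neighbours[OF U] by (intro card_mono finite_SigmaI) auto
  also have "\<dots> = (\<Sum>x\<in>Q. card {y. (x, y) \<in> part_pairs U})"
    using Q finite_neighbours[OF U] by (intro card_SigmaI) auto
  also have "\<dots> \<le> (\<Sum>x\<in>Q. k)" using card_neighbours_le[OF U] by (intro sum_mono)
  finally show ?thesis by (simp add: mult.commute)
qed

lemma card_pairs_le:
  assumes U: "U \<in> UU" and X: "X \<subseteq> part_pairs U"
  shows "card X \<le> k * card V"
proof -
  have "{p\<in>X. fst p \<in> V} = X" using X part_pairs_subset[OF U] by auto
  then show ?thesis using card_pairs_from_le[OF U X fin_ground] by simp
qed

section \<open>Counting partitions with prescribed pairs\<close>

lemma containing_swap_closed:
  assumes "U \<in> containing M" "M \<subseteq> Q \<times> Q" "x \<in> V - Q" "z \<in> V - Q"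
  shows "swap_points x z U \<in> containing M"
proof -
  have "(u, v) \<in> part_pairs (swap_points x z U)" if "(u, v) \<in> M" for u v
  proof -
    have "u \<in> Q" "v \<in> Q" "(u, v) \<in> part_pairs U" using that assms(1,2) by (auto simp: containing_def)
    then show ?thesis using assms(3,4) by (auto simp: part_pairs_swap_points transpose_def)
  qed
  then show ?thesis using assms swap_closed by (auto simp: containing_def)
qed

text \<open>Swapping \<open>x\<close> with any \<open>z\<close> outside \<open>Q\<close> stays in the family, and afterwards \<open>z\<close> is one of
  the at most \<open>k\<close> points sharing a part with \<open>y\<close>.\<close>

lemma card_with_pair_le:
  assumes M: "M \<subseteq> Q \<times> Q" and Q: "Q \<subseteq> V" and x: "x \<in> V - Q" and y: "y \<noteq> x"
  shows "card (containing (insert (x, y) M)) * (card V - card Q - 1) \<le> k * card (containing M)"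
proof -
  let ?W = "containing M" and ?Z = "V - Q - {y}"
  let ?f = "\<lambda>(U, z). (swap_points x z U, z)"
  have fW: "finite ?W" using finite_subset[OF containing_subset finite_family] .
  \<comment> \<open>The \<open>- 1\<close> pays for excluding \<open>y\<close> from the swap
    partners \<open>z\<close>.\<close>
  have "card V - card Q - 1 \<le> card (V - Q) - 1"
    using Q fin_ground by (simp add: card_Diff_subset finite_subset)
  also have "\<dots> \<le> card ?Z" using diff_card_le_card_Diff[of "{y}" "V - Q"] by simp
  finally have "card (containing (insert (x, y) M)) * (card V - card Q - 1)
      \<le> card (containing (insert (x, y) M) \<times> ?Z)"
    by (simp add: card_cartesian_product)
  also have "\<dots> \<le> card (SIGMA U:?W. {z. (y, z) \<in> part_pairs U})"
  proof (rule card_inj_on_le)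
    show "inj_on ?f (containing (insert (x, y) M) \<times> ?Z)"
      by (rule inj_on_inverseI[where g = "\<lambda>(U, z). (swap_points x z U, z)"])
        (auto simp: swap_points_involutory)
    show "?f ` (containing (insert (x, y) M) \<times> ?Z) \<subseteq> (SIGMA U:?W. {z. (y, z) \<in> part_pairs U})"
    proof (rule image_subsetI)
      fix p assume "p \<in> containing (insert (x, y) M) \<times> ?Z"
      then obtain U z where p: "p = (U, z)" and U: "U \<in> containing (insert (x, y) M)"
        and z: "z \<in> V" "z \<notin> Q" "z \<noteq> y" by auto
      have "(y, x) \<in> part_pairs U" using U by (auto simp: containing_def intro: part_pairs_sym)
      then have "(y, z) \<in> part_pairs (swap_points x z U)"
        using y z by (auto simp: part_pairs_swap_points transpose_def)
      moreover have "U \<in> ?W" using U by (auto simp: containing_def)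
      ultimately show "?f p \<in> (SIGMA U:?W. {z. (y, z) \<in> part_pairs U})"
        using containing_swap_closed[OF _ M x] z p by auto
    qed
    show "finite (SIGMA U:?W. {z. (y, z) \<in> part_pairs U})"
      using fW finite_neighbours containing_subset by (intro finite_SigmaI) auto
  qed
  also have "\<dots> = (\<Sum>U\<in>?W. card {z. (y, z) \<in> part_pairs U})"
    using fW finite_neighbours containing_subset by (intro card_SigmaI) auto
  also have "\<dots> \<le> (\<Sum>U\<in>?W. k)"
    using card_neighbours_le containing_subset by (intro sum_mono) auto
  finally show ?thesis by (simp add: mult.commute)
qed

text \<open>Greedy choice of \<open>j\<close> pairs from \<open>X\<close>: the at most
  \<open>2 * i\<close> points used so far start at most \<open>2 * k * i\<close> pairs of
  \<open>X\<close>, so some pair starts at a fresh point. Each chosen pair costs a factor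
  \<open>2 * k / card V\<close>.\<close>

lemma card_containing_le:
  assumes U: "U \<in> UU" and X: "X \<subseteq> part_pairs U" and j: "4 * k * j \<le> card X"
  shows "real (card (containing X)) * (real (card V) / 2) ^ j \<le> real k ^ j * real (card UU)"
proof -
  have fX: "finite X" using X finite_part_pairs[OF U] finite_subset by blast
  have "4 * k * j \<le> k * card V" using j card_pairs_le[OF U X] by linarith
  then have j4: "4 * j \<le> card V" using k_pos by simp
  have claim: "i \<le> j \<Longrightarrow> \<exists>M Q. M \<subseteq> X \<and> Q \<subseteq> V \<and> card Q \<le> 2 * i \<and> M \<subseteq> Q \<times> Q \<and>
      real (card (containing M)) * (real (card V) / 2) ^ i \<le> real k ^ i * real (card UU)" for i
  proof (induction i)
    case 0
    show ?case by (rule exI[of _ "{}"], rule exI[of _ "{}"]) (simp add: containing_def)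
  next
    case (Suc i)
    then obtain M Q where MQ: "M \<subseteq> X" "Q \<subseteq> V" "card Q \<le> 2 * i" "M \<subseteq> Q \<times> Q"
      and IH: "real (card (containing M)) * (real (card V) / 2) ^ i \<le> real k ^ i * real (card UU)"
      by auto
    have fQ: "finite Q" using MQ(2) fin_ground finite_subset by blast
    have "card {p\<in>X. fst p \<in> Q} \<le> k * card Q" by (rule card_pairs_from_le[OF U X fQ])
    also have "\<dots> \<le> k * (2 * i)" using MQ(3) by simp
    also have "\<dots> < 4 * k * j" using Suc.prems k_pos by simp
    also have "\<dots> \<le> card X" by fact
    finally have "{p\<in>X. fst p \<in> Q} \<noteq> X" by auto
    then obtain p where "p \<in> X" "fst p \<notin> Q" by blast
    then obtain x y where xy: "(x, y) \<in> X" "x \<notin> Q" by (metis prod.collapse)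
    have xyU: "(x, y) \<in> part_pairs U" using xy(1) X by (rule subsetD[rotated])
    have xyV: "x \<in> V" "y \<in> V" "x \<noteq> y"
      using xyU part_pairs_subset[OF U] part_pairs_irrefl[OF xyU] by auto
    let ?M = "insert (x, y) M"
    \<comment> \<open>\<open>4 * j \<le> card V\<close> keeps at least half of the points available
      as swap partners.\<close>
    have N: "real (card V) / 2 \<le> real (card V - card Q - 1)"
      using j4 Suc.prems MQ(3) by simp
    have "real (card (containing ?M)) * (real (card V) / 2)
        \<le> real (card (containing ?M)) * real (card V - card Q - 1)"
      using N by (intro mult_left_mono) auto
    also have "\<dots> \<le> real (k * card (containing M))"
      using card_with_pair_le[OF MQ(4,2), of x y] xyV xy(2) by (simp flip: of_nat_mult)
    finally have st: "real (card (containing ?M)) * (real (card V) / 2) \<le> real k * real (card (containing M))"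
      by simp
    have "real (card (containing ?M)) * (real (card V) / 2) ^ Suc i
        = (real (card (containing ?M)) * (real (card V) / 2)) * (real (card V) / 2) ^ i" by simp
    also have "\<dots> \<le> (real k * real (card (containing M))) * (real (card V) / 2) ^ i"
      using st by (intro mult_right_mono) auto
    also have "\<dots> = real k * (real (card (containing M)) * (real (card V) / 2) ^ i)" by simp
    also have "\<dots> \<le> real k * (real k ^ i * real (card UU))"
      using IH by (intro mult_left_mono) auto
    finally have b: "real (card (containing ?M)) * (real (card V) / 2) ^ Suc i \<le> real k ^ Suc i * real (card UU)"
      by simp
    have "card (Q \<union> {x, y}) \<le> 2 * Suc i"
      using card_Un_le[of Q "{x, y}"] MQ(3) xyV by simp
    then show ?case
      using b MQ xy xyV by (intro exI[of _ ?M] exI[of _ "Q \<union> {x, y}"]) auto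
  qed
  obtain M where M: "M \<subseteq> X" and b: "real (card (containing M)) * (real (card V) / 2) ^ j \<le> real k ^ j * real (card UU)"
    using claim[of j] by auto
  have "card (containing X) \<le> card (containing M)"
    using M finite_subset[OF containing_subset finite_family] by (intro card_mono) (auto simp: containing_def)
  then have "real (card (containing X)) * (real (card V) / 2) ^ j \<le> real (card (containing M)) * (real (card V) / 2) ^ j"
    by (intro mult_right_mono) auto
  with b show ?thesis by linarith
qed

text \<open>For nonempty \<open>T\<close> inside \<open>V\<close> these are the members having a
  part that contains \<open>T\<close>.\<close>

abbreviation star :: "'a set \<Rightarrow> 'a set set set" where
  "star T \<equiv> containing (T \<times> T - Id)"

lemma finite_star: "finite (star T)"
  by (rule finite_subset[OF containing_subset finite_family])

text \<open>A point \<open>x\<close> of \<open>T'\<close> outside \<open>T\<close> has a partner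
  \<open>y\<close> in \<open>T'\<close>. Members of both stars thus contain a pair starting outside
  \<open>T\<close>, which \<open>card_with_pair_le\<close> makes rare within
  \<open>star T\<close>.\<close>

lemma card_two_stars_le:
  assumes "T \<subseteq> V" "T' \<subseteq> V" "card T = t" "card T' = t" "2 \<le> t" "T \<noteq> T'"
  shows "card (star T \<inter> star T') * (card V - t - 1) \<le> k * card (star T)"
proof -
  have "finite T" "finite T'" using assms(1,2) fin_ground finite_subset by auto
  have "\<not> T' \<subseteq> T" using assms(3,4,6) \<open>finite T\<close> card_subset_eq by metis
  then obtain x where x: "x \<in> T'" "x \<notin> T" by auto
  have "T' \<noteq> {x}" using assms(4,5) by auto
  then obtain y where y: "y \<in> T'" "y \<noteq> x" using x by auto
  have "star T \<inter> star T' \<subseteq> containing (insert (x, y) (T \<times> T - Id))"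
    using x y by (auto simp: containing_def)
  then have "card (star T \<inter> star T') \<le> card (containing (insert (x, y) (T \<times> T - Id)))"
    by (intro card_mono finite_subset[OF containing_subset finite_family])
  then have "card (star T \<inter> star T') * (card V - t - 1)
      \<le> card (containing (insert (x, y) (T \<times> T - Id))) * (card V - card T - 1)"
    using assms(3) by (intro mult_le_mono) auto
  also have "\<dots> \<le> k * card (star T)"
    using x y assms by (intro card_with_pair_le) auto
  finally show ?thesis .
qed

section \<open>Partitions in a star avoiding a given partition\<close>

text \<open>When it is empty, any set of at least two points lying in a part of both partitions is
  contained in \<open>T\<close>.\<close>

definition extra_common :: "'a set \<Rightarrow> 'a set set \<Rightarrow> 'a set set \<Rightarrow> ('a \<times> 'a) set" where
  "extra_common T U0 U = part_pairs U \<inter> part_pairs U0 - T \<times> T"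

lemma finite_extra_common: "U \<in> UU \<Longrightarrow> finite (extra_common T U0 U)"
  using finite_part_pairs by (simp add: extra_common_def)

text \<open>The swap exchanges the neighbourhoods of \<open>b\<close> and \<open>z\<close>. By
  \<open>z1\<close> the old part of \<open>z\<close> holds no neighbour of \<open>b\<close> in
  \<open>U0\<close>, and by \<open>z2\<close> the old part of \<open>b\<close> holds no neighbour of
  \<open>z\<close> in \<open>U0\<close>. So no common pair remains at \<open>b\<close> or
  \<open>z\<close>, and pairs elsewhere are unchanged.\<close>

lemma swap_removes_common_pair:
  assumes U: "U \<in> UU" and U0: "U0 \<in> UU" and ab: "(a, b) \<in> extra_common T U0 U"
    and z: "z \<noteq> b" "(b, z) \<notin> part_pairs U"
    and z1: "\<And>w. (b, w) \<in> part_pairs U0 \<Longrightarrow> (w, z) \<notin> part_pairs U"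
    and z2: "\<And>w. (b, w) \<in> part_pairs U \<Longrightarrow> (w, z) \<notin> part_pairs U0"
  shows "extra_common T U0 (swap_points b z U) \<subset> extra_common T U0 U"
proof -
  have aU: "(a, b) \<in> part_pairs U" "(a, b) \<in> part_pairs U0" using ab by (auto simp: extra_common_def)
  have not_b: "(b, y) \<notin> part_pairs U0" if "(b, y) \<in> part_pairs (swap_points b z U)" for y
  proof
    assume by0: "(b, y) \<in> part_pairs U0"
    have "y \<noteq> b" using part_pairs_irrefl[OF by0] by simp
    moreover have "(z, transpose b z y) \<in> part_pairs U" using that by (simp add: part_pairs_swap_points)
    ultimately show False
      using z z1[OF by0] part_pairs_sym[of z _ U] by (cases "y = z") (auto simp: transpose_def)
  qed
  have not_z: "(z, y) \<notin> part_pairs U0" if "(z, y) \<in> part_pairs (swap_points b z U)" for y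
  proof
    assume zy: "(z, y) \<in> part_pairs U0"
    have "y \<noteq> z" using part_pairs_irrefl[OF zy] by simp
    moreover have "(b, transpose b z y) \<in> part_pairs U" using that by (simp add: part_pairs_swap_points)
    ultimately show False
      using z z2[of y] part_pairs_sym[OF zy] by (cases "y = b") (auto simp: transpose_def)
  qed
  have "(x, y) \<in> part_pairs U"
    if "(x, y) \<in> part_pairs (swap_points b z U)" "(x, y) \<in> part_pairs U0" for x y
  proof -
    have "x \<noteq> b" "x \<noteq> z" using that not_b not_z by auto
    moreover have "y \<noteq> b" "y \<noteq> z"
      using part_pairs_sym[OF that(1)] part_pairs_sym[OF that(2)] not_b not_z by auto
    ultimately show ?thesis using that(1) by (simp add: part_pairs_swap_points)
  qed
  then have "extra_common T U0 (swap_points b z U) \<subseteq> extra_common T U0 U"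
    by (auto simp: extra_common_def)
  moreover have "(a, b) \<notin> extra_common T U0 (swap_points b z U)"
  proof
    assume "(a, b) \<in> extra_common T U0 (swap_points b z U)"
    then have "(b, a) \<in> part_pairs (swap_points b z U)"
      by (auto simp: extra_common_def intro: part_pairs_sym)
    from not_b[OF this] show False using part_pairs_sym[OF aU(2)] by contradiction
  qed
  ultimately show ?thesis using ab by blast
qed

text \<open>Switching: for a common pair \<open>(a, b)\<close> outside \<open>T \<times> T\<close> with \<open>b \<notin> T\<close>, at least half of the
  points \<open>z\<close> give a swap of \<open>b\<close> and \<open>z\<close> that destroys this pair and creates no common pair. The
  swap is recovered from its result by choosing \<open>b\<close>, then \<open>a\<close> in the part of \<open>b\<close> in \<open>U0\<close>, then \<open>z\<close>
  in the new part of \<open>a\<close>.\<close>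

lemma card_level_le:
  assumes U0: "U0 \<in> UU" and T: "T \<subseteq> V" and j: "0 < j"
    and N: "2 * (card T + 1 + k + 2 * k * k) \<le> card V"
  shows "card {U\<in>star T. card (extra_common T U0 U) = j}
       \<le> 2 * k * k * card {U\<in>star T. card (extra_common T U0 U) < j}"
proof -
  let ?D = "{U\<in>star T. card (extra_common T U0 U) = j}"
  let ?L = "{U\<in>star T. card (extra_common T U0 U) < j}"
  have fD: "finite ?D" and fL: "finite ?L" using finite_star by auto
  have ex: "\<exists>p. p \<in> extra_common T U0 U \<and> snd p \<notin> T" if "U \<in> ?D" for U
  proof -
    have "extra_common T U0 U \<noteq> {}" using that j by auto
    then obtain a b where ab: "(a, b) \<in> extra_common T U0 U" by auto
    then have "(b, a) \<in> extra_common T U0 U"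
      by (auto simp: extra_common_def intro: part_pairs_sym)
    moreover have "a \<notin> T \<or> b \<notin> T" using ab by (auto simp: extra_common_def)
    ultimately show ?thesis using ab by (metis snd_conv)
  qed
  define p where "p U = (SOME p. p \<in> extra_common T U0 U \<and> snd p \<notin> T)" for U
  define a b where "a U = fst (p U)" and "b U = snd (p U)" for U
  have ab: "(a U, b U) \<in> extra_common T U0 U \<and> b U \<notin> T" if "U \<in> ?D" for U
    using someI_ex[OF ex[OF that]] by (simp add: a_def b_def p_def)
  define Z where "Z U = V - (T \<union> {b U} \<union> {z. (b U, z) \<in> part_pairs U}
      \<union> {z. \<exists>w. (b U, w) \<in> part_pairs U0 \<and> (w, z) \<in> part_pairs U}
      \<union> {z. \<exists>w. (b U, w) \<in> part_pairs U \<and> (w, z) \<in> part_pairs U0})" for U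
  have DU: "U \<in> UU" if "U \<in> ?D" for U using that by (auto simp: containing_def)
  have Zcard: "card V \<le> 2 * card (Z U)" if U: "U \<in> ?D" for U
  proof -
    let ?E = "T \<union> {b U} \<union> {z. (b U, z) \<in> part_pairs U}
      \<union> {z. \<exists>w. (b U, w) \<in> part_pairs U0 \<and> (w, z) \<in> part_pairs U}
      \<union> {z. \<exists>w. (b U, w) \<in> part_pairs U \<and> (w, z) \<in> part_pairs U0}"
    have "card ?E \<le> card T + card {b U} + card {z. (b U, z) \<in> part_pairs U}
      + card {z. \<exists>w. (b U, w) \<in> part_pairs U0 \<and> (w, z) \<in> part_pairs U}
      + card {z. \<exists>w. (b U, w) \<in> part_pairs U \<and> (w, z) \<in> part_pairs U0}"
      by (meson add_mono card_Un_le order_refl order_trans)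
    also have "\<dots> \<le> card T + 1 + k + k * k + k * k"
      using card_neighbours_le[OF DU[OF U]] card_second_neighbours_le DU[OF U] U0
      by (intro add_mono) auto
    finally have E: "2 * card ?E \<le> card V" using N by simp
    have "finite ?E"
    proof (rule finite_subset[OF _ fin_ground])
      have "b U \<in> V" using ab[OF U] part_pairs_subset[OF U0] by (auto simp: extra_common_def)
      then show "?E \<subseteq> V" using T part_pairs_subset[OF U0] part_pairs_subset[OF DU[OF U]] by auto
    qed
    then have "card V - card ?E \<le> card (Z U)" unfolding Z_def by (rule diff_card_le_card_Diff)
    with E show ?thesis by linarith
  qed
  have fZ: "finite (Z U)" for U unfolding Z_def using fin_ground by simp
  let ?f = "\<lambda>(U, z). (swap_points (b U) z U, b U, a U, z)"
  define Tgt where "Tgt = (SIGMA U':?L. SIGMA b:V. SIGMA a:{a. (b, a) \<in> part_pairs U0}. {z. (a, z) \<in> part_pairs U'})"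
  have fin1: "finite {z. (a, z) \<in> part_pairs U'}" if "U' \<in> ?L" for U' a
    using that finite_neighbours containing_subset by auto
  have "card V * card ?D \<le> 2 * (\<Sum>U\<in>?D. card (Z U))"
    using sum_mono[of ?D "\<lambda>_. card V" "\<lambda>U. 2 * card (Z U)"] Zcard
    by (simp add: sum_distrib_left mult.commute)
  also have "(\<Sum>U\<in>?D. card (Z U)) = card (Sigma ?D Z)"
    using fD fZ by (subst card_SigmaI) auto
  also have "card (Sigma ?D Z) \<le> card Tgt"
  proof (rule card_inj_on_le)
    show "inj_on ?f (Sigma ?D Z)"
      by (rule inj_on_inverseI[where g = "\<lambda>(U, b, a, z). (swap_points b z U, z)"])
        (auto simp: swap_points_involutory)
    show "?f ` Sigma ?D Z \<subseteq> Tgt"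
    proof (rule image_subsetI)
      fix p assume "p \<in> Sigma ?D Z"
      then obtain U z where p: "p = (U, z)" and U: "U \<in> ?D" and z: "z \<in> Z U" by auto
      have abU: "(a U, b U) \<in> part_pairs U" "(a U, b U) \<in> part_pairs U0" "b U \<notin> T"
        using ab[OF U] by (auto simp: extra_common_def)
      have bV: "b U \<in> V" using abU part_pairs_subset[OF U0] by auto
      have zz: "z \<in> V - T" "z \<noteq> b U" "(b U, z) \<notin> part_pairs U" using z by (auto simp: Z_def)
      have "extra_common T U0 (swap_points (b U) z U) \<subset> extra_common T U0 U"
        using ab[OF U] zz z by (intro swap_removes_common_pair[OF DU[OF U] U0]) (auto simp: Z_def)
      then have "card (extra_common T U0 (swap_points (b U) z U)) < j"
        using U finite_extra_common[OF DU[OF U]] by (metis (mono_tags, lifting) mem_Collect_eq psubset_card_mono)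
      moreover have "swap_points (b U) z U \<in> star T"
        using U abU bV zz by (intro containing_swap_closed[of _ _ T]) auto
      moreover have "(b U, a U) \<in> part_pairs U0" using abU part_pairs_sym by metis
      moreover have "(a U, z) \<in> part_pairs (swap_points (b U) z U)"
      proof -
        have "a U \<noteq> b U" using part_pairs_irrefl[OF abU(1)] .
        moreover have "a U \<noteq> z" using zz(3) part_pairs_sym[OF abU(1)] by auto
        ultimately show ?thesis using abU(1) by (simp add: part_pairs_swap_points)
      qed
      ultimately show "?f p \<in> Tgt" using p bV by (simp add: Tgt_def)
    qed
    show "finite Tgt"
      unfolding Tgt_def using fin1 finite_neighbours[OF U0] fin_ground fL
      by (intro finite_SigmaI) auto
  qed
  also have "card Tgt \<le> card ?L * (card V * (k * k))"
  proof -
    have c1: "card (SIGMA a:{a. (b, a) \<in> part_pairs U0}. {z. (a, z) \<in> part_pairs U'}) \<le> k * k"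
      if "U' \<in> ?L" for U' b
    proof -
      have "card (SIGMA a:{a. (b, a) \<in> part_pairs U0}. {z. (a, z) \<in> part_pairs U'})
          = (\<Sum>a\<in>{a. (b, a) \<in> part_pairs U0}. card {z. (a, z) \<in> part_pairs U'})"
        using fin1[OF that] finite_neighbours[OF U0] by (intro card_SigmaI) auto
      also have "\<dots> \<le> (\<Sum>a\<in>{a. (b, a) \<in> part_pairs U0}. k)"
        using that card_neighbours_le containing_subset by (intro sum_mono) auto
      also have "\<dots> \<le> k * k" using card_neighbours_le[OF U0] by simp
      finally show ?thesis .
    qed
    have f1: "finite (SIGMA a:{a. (b, a) \<in> part_pairs U0}. {z. (a, z) \<in> part_pairs U'})"
      if "U' \<in> ?L" for U' b
      using fin1[OF that] finite_neighbours[OF U0] by (intro finite_SigmaI) auto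
    have c2: "card (SIGMA b:V. SIGMA a:{a. (b, a) \<in> part_pairs U0}. {z. (a, z) \<in> part_pairs U'})
        \<le> card V * (k * k)" if "U' \<in> ?L" for U'
    proof -
      have "card (SIGMA b:V. SIGMA a:{a. (b, a) \<in> part_pairs U0}. {z. (a, z) \<in> part_pairs U'})
          = (\<Sum>b\<in>V. card (SIGMA a:{a. (b, a) \<in> part_pairs U0}. {z. (a, z) \<in> part_pairs U'}))"
        by (rule card_SigmaI[OF fin_ground]) (use f1[OF that] in blast)
      also have "\<dots> \<le> (\<Sum>b\<in>V. k * k)" using c1[OF that] by (intro sum_mono)
      finally show ?thesis by simp
    qed
    have f2: "finite (SIGMA b:V. SIGMA a:{a. (b, a) \<in> part_pairs U0}. {z. (a, z) \<in> part_pairs U'})"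
      if "U' \<in> ?L" for U'
      by (rule finite_SigmaI[OF fin_ground]) (use f1[OF that] in blast)
    have "card Tgt = (\<Sum>U'\<in>?L. card (SIGMA b:V. SIGMA a:{a. (b, a) \<in> part_pairs U0}. {z. (a, z) \<in> part_pairs U'}))"
      unfolding Tgt_def by (rule card_SigmaI[OF fL]) (use f2 in blast)
    also have "\<dots> \<le> (\<Sum>U'\<in>?L. card V * (k * k))" using c2 by (intro sum_mono)
    finally show ?thesis by simp
  qed
  finally have "card V * card ?D \<le> card V * (2 * k * k * card ?L)"
    by (simp add: algebra_simps)
  moreover have "0 < card V" using N by simp
  ultimately show ?thesis by simp
qed

text \<open>Each level adds at most \<open>2 * k * k\<close> times the number of members below it,
  so the counts grow by at most \<open>1 + 2 * k * k\<close> per level.\<close>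

lemma card_levels_le:
  assumes U0: "U0 \<in> UU" and T: "T \<subseteq> V"
    and N: "2 * (card T + 1 + k + 2 * k * k) \<le> card V"
  shows "card {U\<in>star T. card (extra_common T U0 U) \<le> m}
       \<le> (1 + 2 * k * k) ^ m * card {U\<in>star T. extra_common T U0 U = {}}"
proof (induction m)
  case 0
  have "card (extra_common T U0 U) = 0 \<longleftrightarrow> extra_common T U0 U = {}" if "U \<in> star T" for U
    using finite_extra_common[of U T U0] that by (simp add: containing_def)
  then have "{U\<in>star T. card (extra_common T U0 U) \<le> 0} = {U\<in>star T. extra_common T U0 U = {}}" by auto
  then show ?case by simp
next
  case (Suc m)
  let ?L = "\<lambda>m. {U\<in>star T. card (extra_common T U0 U) \<le> m}"
  have "?L (Suc m) = ?L m \<union> {U\<in>star T. card (extra_common T U0 U) = Suc m}" by auto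
  then have "card (?L (Suc m)) \<le> card (?L m) + card {U\<in>star T. card (extra_common T U0 U) = Suc m}"
    by (simp add: card_Un_le)
  also have "\<dots> \<le> card (?L m) + 2 * k * k * card (?L m)"
    using card_level_le[OF U0 T _ N, of "Suc m"] by (simp add: less_Suc_eq_le)
  also have "\<dots> = (1 + 2 * k * k) * card (?L m)" by simp
  also have "\<dots> \<le> (1 + 2 * k * k) * ((1 + 2 * k * k) ^ m * card {U\<in>star T. extra_common T U0 U = {}})"
    using Suc.IH by (intro mult_left_mono) auto
  finally show ?case by (simp only: power_Suc mult.assoc)
qed

text \<open>Double counting: \<open>U0\<close> has at most \<open>k * card V\<close> pairs outside
  \<open>T \<times> T\<close>. Each has an endpoint outside \<open>T\<close>, so it occurs in at
  most a fraction \<open>2 * k / card V\<close> of the star.\<close>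

lemma sum_extra_common_le:
  assumes U0: "U0 \<in> UU" and T: "T \<subseteq> V"
    and N: "2 * (card T + 1 + k + 2 * k * k) \<le> card V"
  shows "(\<Sum>U\<in>star T. card (extra_common T U0 U)) \<le> 2 * k * k * card (star T)"
proof -
  let ?X = "part_pairs U0 - T \<times> T"
  let ?c = "\<lambda>x y. card (containing (insert (x, y) (T \<times> T - Id)))"
  have fX: "finite ?X" using finite_part_pairs[OF U0] by simp
  have "2 * (card T + 1) \<le> card V" using N by simp
  then have Nt: "card V \<le> 2 * (card V - card T - 1)" by arith
  have bound': "?c x y * card V \<le> 2 * (k * card (star T))" if "x \<in> V" "x \<notin> T" "y \<noteq> x" for x y
  proof -
    have "?c x y * card V \<le> 2 * (?c x y * (card V - card T - 1))"
      using mult_left_mono[OF Nt, of "?c x y"] by simp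
    also have "\<dots> \<le> 2 * (k * card (star T))"
      using that T by (intro mult_left_mono card_with_pair_le) auto
    finally show ?thesis .
  qed
  have bound: "card {U\<in>star T. p \<in> part_pairs U} * card V \<le> 2 * (k * card (star T))" if "p \<in> ?X" for p
  proof -
    obtain x y where p: "p = (x, y)" by (cases p)
    have pU0: "(x, y) \<in> part_pairs U0" using that p by simp
    have xy: "x \<in> V" "y \<in> V" "x \<noteq> y"
      using pU0 part_pairs_subset[OF U0] part_pairs_irrefl[OF pU0] by auto
    have e: "{U\<in>star T. p \<in> part_pairs U} = containing (insert (x, y) (T \<times> T - Id))"
      "{U\<in>star T. p \<in> part_pairs U} = containing (insert (y, x) (T \<times> T - Id))"
      using p part_pairs_sym by (auto simp: containing_def)
    have "x \<notin> T \<or> y \<notin> T" using that p by auto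
    then show ?thesis
      using bound'[of x y] bound'[of y x] xy e by metis
  qed
  have "(\<Sum>U\<in>star T. card (extra_common T U0 U)) = (\<Sum>U\<in>star T. \<Sum>p\<in>?X. if p \<in> part_pairs U then 1 else 0)"
  proof (rule sum.cong)
    fix U assume "U \<in> star T"
    have "extra_common T U0 U = {p\<in>?X. p \<in> part_pairs U}" by (auto simp: extra_common_def)
    then show "card (extra_common T U0 U) = (\<Sum>p\<in>?X. if p \<in> part_pairs U then 1 else 0)"
      using fX by (simp add: sum.If_cases Int_def)
  qed simp
  also have "\<dots> = (\<Sum>p\<in>?X. \<Sum>U\<in>star T. if p \<in> part_pairs U then 1 else 0)" by (rule sum.swap)
  also have "\<dots> = (\<Sum>p\<in>?X. card {U\<in>star T. p \<in> part_pairs U})"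
    using finite_star by (simp add: sum.If_cases Int_def)
  finally have "(\<Sum>U\<in>star T. card (extra_common T U0 U)) * card V
      = (\<Sum>p\<in>?X. card {U\<in>star T. p \<in> part_pairs U} * card V)"
    by (simp add: sum_distrib_right)
  also have "\<dots> \<le> (\<Sum>p\<in>?X. 2 * (k * card (star T)))" by (intro sum_mono bound)
  also have "\<dots> = card ?X * (2 * (k * card (star T)))" by simp
  also have "\<dots> \<le> (k * card V) * (2 * (k * card (star T)))"
    using card_pairs_le[OF U0, of ?X] by (intro mult_right_mono) auto
  finally have "(\<Sum>U\<in>star T. card (extra_common T U0 U)) * card V \<le> (2 * k * k * card (star T)) * card V"
    by (simp add: algebra_simps)
  then show ?thesis using N by simp
qed

text \<open>Markov's inequality: the average number of extra common pairs is at most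
  \<open>2 * k * k\<close>, so at least half of the star has at most \<open>4 * k * k\<close>.
  Switching brings these down to level \<open>0\<close> at a constant factor.\<close>

lemma card_star_le_no_extra_common:
  assumes U0: "U0 \<in> UU" and T: "T \<subseteq> V"
    and N: "2 * (card T + 1 + k + 2 * k * k) \<le> card V"
  shows "card (star T) \<le> 2 * (1 + 2 * k * k) ^ (4 * k * k) * card {U\<in>star T. extra_common T U0 U = {}}"
proof -
  let ?m = "4 * k * k"
  let ?H = "{U\<in>star T. ?m < card (extra_common T U0 U)}"
  let ?L = "{U\<in>star T. card (extra_common T U0 U) \<le> ?m}"
  have "?m * card ?H \<le> (\<Sum>U\<in>?H. card (extra_common T U0 U))"
    using sum_mono[of ?H "\<lambda>_. ?m" "\<lambda>U. card (extra_common T U0 U)"] by (simp add: mult.commute)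
  also have "\<dots> \<le> (\<Sum>U\<in>star T. card (extra_common T U0 U))"
    using finite_star by (intro sum_mono2) auto
  also have "\<dots> \<le> 2 * k * k * card (star T)" by (rule sum_extra_common_le[OF assms])
  finally have "(2 * k * k) * (2 * card ?H) \<le> (2 * k * k) * card (star T)" by simp
  then have H: "2 * card ?H \<le> card (star T)" using k_pos by simp
  have "star T = ?H \<union> ?L" by auto
  then have "card (star T) \<le> card ?H + card ?L" by (metis (no_types, lifting) card_Un_le)
  with H have "card (star T) \<le> 2 * card ?L" by linarith
  with card_levels_le[OF assms, of ?m] show ?thesis by (simp add: mult.assoc)
qed

section \<open>Spread approximation\<close>

text \<open>This is \<open>r\<close>-spreadness of the link of \<open>X\<close>: every further
  prescribed pair costs a factor \<open>r\<close>.\<close>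

definition spread_above :: "real \<Rightarrow> 'a set set set \<Rightarrow> ('a \<times> 'a) set \<Rightarrow> bool" where
  "spread_above r G X \<longleftrightarrow> G \<noteq> {} \<and> G \<subseteq> containing X \<and> X \<subseteq> V \<times> V \<and>
     (\<forall>Y. X \<subseteq> Y \<and> Y \<subseteq> V \<times> V \<longrightarrow> real (card {U\<in>G. Y \<subseteq> part_pairs U}) * r ^ card (Y - X) \<le> real (card G))"

text \<open>If a proper superset \<open>Y\<close> of a maximal frequent \<open>X\<close> violated
  spreadness, \<open>Y\<close> would itself be frequent.\<close>

lemma ex_spread_above:
  assumes G: "G \<subseteq> UU" "G \<noteq> {}" and r: "0 < r"
  shows "\<exists>X. spread_above r {U\<in>G. X \<subseteq> part_pairs U} X
           \<and> real (card G) \<le> r ^ card X * real (card {U\<in>G. X \<subseteq> part_pairs U})"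
proof -
  let ?G = "\<lambda>X. {U\<in>G. X \<subseteq> part_pairs U}"
  have fG: "finite G" using G finite_family finite_subset by blast
  have cG: "card G > 0" using fG G by (simp add: card_gt_0_iff)
  define C where "C = {X. X \<subseteq> V \<times> V \<and> real (card G) \<le> r ^ card X * real (card (?G X))}"
  have fV: "finite (V \<times> V)" using fin_ground by simp
  have "finite C" unfolding C_def by (rule finite_subset[of _ "Pow (V \<times> V)"]) (use fV in auto)
  \<comment> \<open>The empty set of pairs qualifies, with equality.\<close>
  moreover have "C \<noteq> {}" unfolding C_def by (simp, rule exI[of _ "{}"]) simp
  ultimately have "\<exists>X\<in>C. \<forall>Y\<in>C. X \<subseteq> Y \<longrightarrow> X = Y" by (rule finite_has_maximal)
  then obtain X where X: "X \<in> C" and max: "\<And>Y. Y \<in> C \<Longrightarrow> X \<subseteq> Y \<Longrightarrow> X = Y" by blast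
  have big: "real (card G) \<le> r ^ card X * real (card (?G X))" and XV: "X \<subseteq> V \<times> V" using X by (auto simp: C_def)
  have ne: "?G X \<noteq> {}"
  proof
    assume e: "?G X = {}"
    from big cG show False unfolding e by simp
  qed
  have "real (card {U\<in>?G X. Y \<subseteq> part_pairs U}) * r ^ card (Y - X) \<le> real (card (?G X))"
    if Y: "X \<subseteq> Y" "Y \<subseteq> V \<times> V" for Y
  proof (cases "Y = X")
    case True
    then show ?thesis by simp
  next
    case False
    have "\<not> real (card G) \<le> r ^ card Y * real (card (?G Y))" using max[of Y] Y False by (auto simp: C_def)
    then have "r ^ card Y * real (card (?G Y)) \<le> r ^ card X * real (card (?G X))" using big by linarith
    moreover have "finite X" "finite Y" using Y fV by (auto intro: finite_subset)
    then have "card Y = card X + card (Y - X)" using Y(1) by (simp add: card_Diff_subset card_mono)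
    moreover have "{U\<in>?G X. Y \<subseteq> part_pairs U} = ?G Y" using Y(1) by auto
    ultimately have "r ^ card X * (real (card {U\<in>?G X. Y \<subseteq> part_pairs U}) * r ^ card (Y - X))
        \<le> r ^ card X * real (card (?G X))"
      by (simp add: power_add mult.commute mult.left_commute)
    then show ?thesis using r by simp
  qed
  then have "spread_above r (?G X) X"
    unfolding spread_above_def using ne XV G(1) by (auto simp: containing_def)
  with big show ?thesis by blast
qed

text \<open>Each of the at most \<open>m\<close> pairs of \<open>X' - X\<close> lies in at most a
  fraction \<open>1 / r\<close> of \<open>G\<close>, so avoiding all of them keeps at least half of
  \<open>G\<close>. This loss of a factor \<open>2\<close> is absorbed by passing from
  \<open>r\<close> to \<open>r / 2\<close>, as \<open>2 \<le> 2 ^ card Y\<close> for nonempty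
  \<open>Y\<close>.\<close>

lemma spread_family_avoiding:
  assumes sp: "spread_above r G X" and X': "X' \<subseteq> V \<times> V" "card X' \<le> m" and r: "2 * real m \<le> r" "0 < r"
  shows "spread_family (V \<times> V) {U\<in>G. part_pairs U \<inter> (X' - X) = {}} (\<lambda>U. part_pairs U - X) (r / 2)"
proof -
  let ?H = "{U\<in>G. part_pairs U \<inter> (X' - X) = {}}"
  let ?G = "\<lambda>Y. {U\<in>G. Y \<subseteq> part_pairs U}"
  have G: "G \<noteq> {}" "G \<subseteq> containing X" "X \<subseteq> V \<times> V"
    and spr: "\<And>Y. X \<subseteq> Y \<Longrightarrow> Y \<subseteq> V \<times> V \<Longrightarrow> real (card (?G Y)) * r ^ card (Y - X) \<le> real (card G)"
    using sp by (auto simp: spread_above_def)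
  have GU: "G \<subseteq> UU" using G(2) containing_subset by blast
  have fG: "finite G" using GU finite_family finite_subset by blast
  have cG: "card G > 0" using fG G by (simp add: card_gt_0_iff)
  have fV: "finite (V \<times> V)" using fin_ground by simp
  have fX': "finite X'" using X' fV finite_subset by blast
  have "G - ?H \<subseteq> (\<Union>e\<in>X' - X. ?G (insert e X))"
    using G(2) by (auto simp: containing_def)
  then have "card (G - ?H) \<le> card (\<Union>e\<in>X' - X. ?G (insert e X))"
    using fG fX' by (intro card_mono) auto
  also have "\<dots> \<le> (\<Sum>e\<in>X' - X. card (?G (insert e X)))" using fX' by (intro card_UN_le) auto
  finally have "real (card (G - ?H)) * r \<le> (\<Sum>e\<in>X' - X. real (card (?G (insert e X)))) * r"
    using r(2) by (simp flip: of_nat_sum)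
  also have "\<dots> = (\<Sum>e\<in>X' - X. real (card (?G (insert e X))) * r)" by (simp add: sum_distrib_right)
  also have "\<dots> \<le> (\<Sum>e\<in>X' - X. real (card G))"
  proof (rule sum_mono)
    fix e assume e: "e \<in> X' - X"
    have "insert e X - X = {e}" using e by auto
    then show "real (card (?G (insert e X))) * r \<le> real (card G)"
      using spr[of "insert e X"] e X'(1) G(3) by auto
  qed
  also have "\<dots> \<le> real m * real (card G)"
    using X'(2) card_mono[OF fX', of "X' - X"] by (simp add: mult_right_mono)
  also have "\<dots> \<le> (r / 2) * real (card G)" using r by (intro mult_right_mono) auto
  finally have "2 * real (card (G - ?H)) \<le> real (card G)" using r(2) by simp
  moreover have "card (G - ?H) = card G - card ?H" using fG by (intro card_Diff_subset) auto
  ultimately have half: "real (card G) \<le> 2 * real (card ?H)" by linarith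
  show ?thesis
  proof
    show "finite (V \<times> V)" "finite ?H" "0 < r / 2" using fV fG r by auto
    show "?H \<noteq> {}"
    proof
      assume e: "?H = {}"
      from half cG show False unfolding e by simp
    qed
    show "part_pairs U - X \<subseteq> V \<times> V" if "U \<in> ?H" for U using that GU part_pairs_subset by blast
    fix Y assume Y: "Y \<subseteq> V \<times> V"
    let ?K = "{U\<in>?H. Y \<subseteq> part_pairs U - X}"
    consider "Y = {}" | "Y \<inter> X \<noteq> {}" | "Y \<noteq> {}" "Y \<inter> X = {}" by blast
    then show "real (card ?K) * (r / 2) ^ card Y \<le> real (card ?H)"
    proof cases
      case 1
      then show ?thesis by simp
    next
      case 2
      then have e: "?K = {}" by blast
      show ?thesis unfolding e by simp
    next
      case 3
      have fY: "finite Y" using Y fV finite_subset by blast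
      have XY: "(X \<union> Y) - X = Y" using 3 by auto
      have "?K \<subseteq> ?G (X \<union> Y)" using G(2) by (auto simp: containing_def)
      then have "card ?K \<le> card (?G (X \<union> Y))" using fG by (intro card_mono) simp_all
      then have "real (card ?K) * r ^ card Y \<le> real (card (?G (X \<union> Y))) * r ^ card Y"
        using r by (intro mult_right_mono) auto
      also have "\<dots> \<le> real (card G)"
        using spr[of "X \<union> Y", unfolded XY] Y G(3) by simp
      also note half
      also have "2 * real (card ?H) \<le> 2 ^ card Y * real (card ?H)"
        using 3 fY power_increasing[of 1 "card Y" "2::real"]
        by (intro mult_right_mono) (auto simp: Suc_le_eq card_gt_0_iff)
      finally show ?thesis by (simp add: power_divide field_simps)
    qed
  qed
qed

text \<open>Each family is first made to avoid the pairs belonging only to the other core.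
  Disjointness of the links then leaves room for common pairs only in
  \<open>X \<inter> X'\<close>.\<close>

lemma spread_above_common_pairs:
  assumes sp: "spread_above r G X" "spread_above r G' X'"
    and m: "card X \<le> m" "card X' \<le> m" and r: "2 * real m \<le> r"
    and b: "6 * real h < b" "3 \<le> b" and h: "0 < h" and R: "4 * real h * b\<^sup>2 \<le> r"
    and size: "real (k * card V) < b ^ h"
  shows "\<exists>U\<in>G. \<exists>U'\<in>G'. part_pairs U \<inter> part_pairs U' \<subseteq> X \<inter> X'"
proof -
  have "0 < 4 * real h * b\<^sup>2" using b h by simp
  then have r0: "0 < r" using R by linarith
  have V: "X \<subseteq> V \<times> V" "X' \<subseteq> V \<times> V" "G \<subseteq> UU" "G' \<subseteq> UU"
    using sp containing_subset by (auto simp: spread_above_def)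
  have sz: "real (card (part_pairs U - Z)) < b ^ h" if U: "U \<in> UU" for U Z
  proof -
    have "card (part_pairs U - Z) \<le> k * card V" by (rule card_pairs_le[OF U]) auto
    then have "real (card (part_pairs U - Z)) \<le> real (k * card V)" by (rule of_nat_mono)
    with size show ?thesis by linarith
  qed
  have "\<exists>U\<in>{U\<in>G. part_pairs U \<inter> (X' - X) = {}}. \<exists>U'\<in>{U\<in>G'. part_pairs U \<inter> (X - X') = {}}.
      (part_pairs U - X) \<inter> (part_pairs U' - X') = {}"
    by (rule spread_families_disjoint_members[OF
          spread_family_avoiding[OF sp(1) V(2) m(2) r r0] spread_family_avoiding[OF sp(2) V(1) m(1) r r0] b h])
      (use R sz V in auto)
  then show ?thesis by blast
qed

text \<open>Containing \<open>X\<close> has probability at most \<open>(2 * k / card V) ^ j\<close>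
  with \<open>j = card X div (4 * k)\<close>, but by \<open>big\<close> at least the inverse of
  \<open>card V ^ Suc t * r ^ card X\<close>. Since \<open>card V\<close> is a power of
  \<open>r\<close>, comparing exponents of \<open>r\<close> bounds \<open>j\<close>.\<close>

lemma card_le_if_not_small:
  assumes X: "X \<subseteq> V \<times> V" and ne: "containing X \<noteq> {}"
    and big: "real (card UU) \<le> real (card V) ^ Suc t * (r ^ card X * real (card (containing X)))"
    and r: "1 < r" "2 * real k \<le> r" "real (card V) = r ^ (16 * k)"
  shows "card X \<le> 4 * k * (2 * t + 3)"
proof -
  define j where "j = card X div (4 * k)"
  obtain U where U: "U \<in> UU" "X \<subseteq> part_pairs U" using ne by (auto simp: containing_def)
  have cU: "real (card UU) > 0" using U finite_family by (auto simp: card_gt_0_iff)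
  have j: "4 * k * j \<le> card X" by (simp add: j_def)
  have j': "card X < 4 * k * (j + 1)"
    using k_pos dividend_less_times_div[of "4 * k" "card X"] by (simp add: j_def)
  let ?c = "real (card (containing X))"
  have "real (card UU) * (real (card V) / 2) ^ j
      \<le> (real (card V) ^ Suc t * (r ^ card X * ?c)) * (real (card V) / 2) ^ j"
    using big by (intro mult_right_mono) auto
  also have "\<dots> = (real (card V) ^ Suc t * r ^ card X) * (?c * (real (card V) / 2) ^ j)" by simp
  also have "\<dots> \<le> (real (card V) ^ Suc t * r ^ card X) * (real k ^ j * real (card UU))"
    using r by (intro mult_left_mono card_containing_le[OF U j]) auto
  finally have "real (card UU) * (real (card V) / 2) ^ j
      \<le> real (card UU) * (real (card V) ^ Suc t * r ^ card X * real k ^ j)"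
    by (simp add: mult.commute mult.left_commute)
  then have "(real (card V) / 2) ^ j \<le> real (card V) ^ Suc t * r ^ card X * real k ^ j"
    using cU by simp
  then have "(real (card V) / 2) ^ j * 2 ^ j \<le> real (card V) ^ Suc t * r ^ card X * real k ^ j * 2 ^ j"
    by (intro mult_right_mono) auto
  then have "real (card V) ^ j \<le> real (card V) ^ Suc t * r ^ card X * (2 * real k) ^ j"
    by (simp add: power_mult_distrib power_divide mult.commute mult.left_commute)
  also have "\<dots> \<le> real (card V) ^ Suc t * r ^ card X * r ^ j"
    using r by (intro mult_left_mono power_mono) auto
  finally have "r ^ (16 * k * j) \<le> r ^ (16 * k * Suc t + card X + j)"
    unfolding r(3) by (simp only: power_mult[symmetric] power_add[symmetric])
  then have "16 * k * j \<le> 16 * k * Suc t + card X + j"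
    using r(1) by (simp only: power_increasing_iff)
  then have "16 * (k * j) \<le> 16 * (k * t) + 16 * k + card X + j" by (simp add: algebra_simps)
  moreover have "j \<le> k * j" using k_pos by simp
  moreover have "card X \<le> 4 * (k * j) + 4 * k" using j' by (simp add: algebra_simps)
  \<comment> \<open>\<open>11 = 16 - 4 - 1\<close>: the \<open>4\<close> comes from
    \<open>card X\<close>, the \<open>1\<close> from \<open>j \<le> k * j\<close>.\<close>
  ultimately have "11 * (k * j) \<le> 16 * (k * t) + 20 * k" by linarith
  then have "k * (11 * j) \<le> k * (16 * t + 20)" by (simp add: algebra_simps)
  then have "11 * j \<le> 16 * t + 20" using k_pos by simp
  then have "j + 1 \<le> 2 * t + 3" by simp
  then have "4 * k * (j + 1) \<le> 4 * k * (2 * t + 3)" by (rule mult_left_mono) simp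
  with j' show ?thesis by linarith
qed

text \<open>For each such \<open>T\<close>, \<open>containing X\<close> is a subset of
  \<open>star T\<close>.\<close>

definition off_diagonal_sets :: "nat \<Rightarrow> ('a \<times> 'a) set \<Rightarrow> 'a set set" where
  "off_diagonal_sets t X = {T. T \<subseteq> V \<and> card T = t \<and> T \<times> T - Id \<subseteq> X}"

lemma exists_off_diagonal_set:
  assumes "U \<in> UU" "A \<in> U" "B \<in> U'" "t \<le> card (A \<inter> B)"
  shows "off_diagonal_sets t (part_pairs U \<inter> part_pairs U') \<noteq> {}"
proof -
  obtain T where T: "T \<subseteq> A \<inter> B" "card T = t" using assms(4) by (metis obtain_subset_with_card_n)
  have "A \<subseteq> V" using assms(1,2) partition partition_onD1 by blast
  then have "T \<in> off_diagonal_sets t (part_pairs U \<inter> part_pairs U')"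
    using T assms(2,3) by (auto simp: off_diagonal_sets_def part_pairs_def)
  then show ?thesis by blast
qed

lemma off_diagonal_subset:
  assumes "2 \<le> card T" "T \<times> T - Id \<subseteq> A \<times> A"
  shows "T \<subseteq> A"
proof
  fix x assume x: "x \<in> T"
  have "T \<noteq> {x}" using assms(1) by auto
  then obtain y where "y \<in> T" "y \<noteq> x" using x by auto
  then show "x \<in> A" using x assms(2) by auto
qed

text \<open>As \<open>t \<ge> 2\<close>, each point of \<open>T\<close> starts a pair in
  \<open>X\<close>, so \<open>T\<close> is a subset of the at most \<open>m\<close> first
  coordinates.\<close>

lemma card_off_diagonal_sets_le:
  assumes "2 \<le> t" "finite X" "card X \<le> m"
  shows "finite (off_diagonal_sets t X)" "card (off_diagonal_sets t X) \<le> 2 ^ m"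
proof -
  have sub: "off_diagonal_sets t X \<subseteq> Pow (fst ` X)"
  proof
    fix T assume "T \<in> off_diagonal_sets t X"
    then have T: "card T = t" "T \<times> T - Id \<subseteq> X" by (auto simp: off_diagonal_sets_def)
    have "T \<subseteq> fst ` X"
    proof
      fix x assume x: "x \<in> T"
      have "T \<noteq> {x}" using assms(1) T by auto
      then obtain y where "y \<in> T" "y \<noteq> x" using x by auto
      then have "(x, y) \<in> X" using x T by auto
      then show "x \<in> fst ` X" by force
    qed
    then show "T \<in> Pow (fst ` X)" by simp
  qed
  show "finite (off_diagonal_sets t X)" using sub assms(2) by (auto intro: finite_subset)
  have "card (off_diagonal_sets t X) \<le> card (Pow (fst ` X))" using sub assms(2) by (intro card_mono) auto
  also have "\<dots> = 2 ^ card (fst ` X)" using assms(2) by (simp add: card_Pow)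
  also have "\<dots> \<le> 2 ^ m"
    using card_image_le[OF assms(2), of fst] assms(3) by (intro power_increasing) auto
  finally show "card (off_diagonal_sets t X) \<le> 2 ^ m" .
qed

text \<open>The stars of all \<open>t\<close>-sets cover the family. This converts bounds relative
  to \<open>card UU\<close> into bounds relative to the largest star.\<close>

lemma card_family_le:
  assumes t: "0 < t" and part: "\<And>U. U \<in> UU \<Longrightarrow> \<exists>A\<in>U. t \<le> card A"
    and c: "\<And>T. T \<subseteq> V \<Longrightarrow> card T = t \<Longrightarrow> card (star T) \<le> c"
  shows "card UU \<le> card V ^ t * c"
proof -
  let ?TT = "{T. T \<subseteq> V \<and> card T = t}"
  have fin: "finite ?TT" using fin_ground by simp
  have "UU \<subseteq> (\<Union>T\<in>?TT. star T)"
  proof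
    fix U assume U: "U \<in> UU"
    then obtain A where A: "A \<in> U" "t \<le> card A" using part by blast
    then have "off_diagonal_sets t (part_pairs U \<inter> part_pairs U) \<noteq> {}"
      using exists_off_diagonal_set[OF U A(1) A(1)] by simp
    then show "U \<in> (\<Union>T\<in>?TT. star T)"
      using U by (auto simp: off_diagonal_sets_def containing_def)
  qed
  then have "card UU \<le> card (\<Union>T\<in>?TT. star T)"
    using fin finite_star by (intro card_mono) auto
  also have "\<dots> \<le> (\<Sum>T\<in>?TT. card (star T))" using fin by (rule card_UN_le)
  also have "\<dots> \<le> (\<Sum>T\<in>?TT. c)" using c by (intro sum_mono) auto
  also have "\<dots> = (card V choose t) * c" using fin_ground by (simp add: n_subsets)
  also have "\<dots> \<le> card V ^ t * c" by (cases "t \<le> card V") (simp_all add: binomial_le_pow binomial_eq_0)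
  finally show ?thesis .
qed

section \<open>Cores of an intersecting family\<close>

definition cores :: "real \<Rightarrow> nat \<Rightarrow> 'a set set set \<Rightarrow> ('a \<times> 'a) set set" where
  "cores r m F = {X. X \<subseteq> V \<times> V \<and> card X \<le> m \<and> (\<exists>G\<subseteq>F. spread_above r G X)}"

text \<open>The two spread subfamilies contain members whose common pairs all lie in both cores;
  these members still have to share \<open>t\<close> points of a part.\<close>

lemma cores_meet:
  assumes F: "\<And>U U'. U \<in> F \<Longrightarrow> U' \<in> F \<Longrightarrow> \<exists>A\<in>U. \<exists>B\<in>U'. t \<le> card (A \<inter> B)" and FU: "F \<subseteq> UU"
    and X: "X \<in> cores r m F" "X' \<in> cores r m F" and r: "2 * real m \<le> r"
    and b: "6 * real h < b" "3 \<le> b" and h: "0 < h" and R: "4 * real h * b\<^sup>2 \<le> r"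
    and size: "real (k * card V) < b ^ h"
  shows "off_diagonal_sets t X \<inter> off_diagonal_sets t X' \<noteq> {}"
proof -
  obtain G where G: "G \<subseteq> F" "spread_above r G X" using X(1) by (auto simp: cores_def)
  obtain G' where G': "G' \<subseteq> F" "spread_above r G' X'" using X(2) by (auto simp: cores_def)
  have m: "card X \<le> m" "card X' \<le> m" using X by (auto simp: cores_def)
  obtain U U' where U: "U \<in> G" "U' \<in> G'" and sub: "part_pairs U \<inter> part_pairs U' \<subseteq> X \<inter> X'"
    using spread_above_common_pairs[OF G(2) G'(2) m r b h R size] by auto
  obtain A B where AB: "A \<in> U" "B \<in> U'" "t \<le> card (A \<inter> B)" using F[of U U'] U G G' by auto
  have "U \<in> UU" using U G FU by auto
  from exists_off_diagonal_set[OF this AB] obtain T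
    where "T \<in> off_diagonal_sets t (part_pairs U \<inter> part_pairs U')" by auto
  then have "T \<in> off_diagonal_sets t X \<inter> off_diagonal_sets t X'"
    using sub unfolding off_diagonal_sets_def by blast
  then show ?thesis by blast
qed

text \<open>If the remainder \<open>D\<close> were large, the set \<open>X\<close> found by
  \<open>ex_spread_above\<close> inside \<open>D\<close> would have bounded size and so be a core of
  \<open>F\<close>, although no member of \<open>D\<close> contains a core.\<close>

lemma card_outside_cores:
  assumes F: "F \<subseteq> UU" and ne: "UU \<noteq> {}"
    and r: "1 < r" "2 * real k \<le> r" "real (card V) = r ^ (16 * k)"
  shows "card (F - (\<Union>X\<in>cores r (4 * k * (2 * t + 3)) F. containing X)) * card V ^ Suc t < card UU"
proof (rule ccontr)
  let ?m = "4 * k * (2 * t + 3)"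
  define D where "D = F - (\<Union>X\<in>cores r ?m F. containing X)"
  assume "\<not> ?thesis"
  then have big: "card UU \<le> card D * card V ^ Suc t" by (simp add: D_def)
  have "0 < card UU" using ne finite_family by (simp add: card_gt_0_iff)
  with big have "D \<noteq> {}" by (intro notI) simp
  have DU: "D \<subseteq> UU" using F by (auto simp: D_def)
  from r have "0 < r" by simp
  let ?G = "\<lambda>X. {U\<in>D. X \<subseteq> part_pairs U}"
  obtain X where sp: "spread_above r (?G X) X" and cX: "real (card D) \<le> r ^ card X * real (card (?G X))"
    using ex_spread_above[OF DU \<open>D \<noteq> {}\<close> \<open>0 < r\<close>] by blast
  have GX: "?G X \<noteq> {}" "?G X \<subseteq> containing X" and XV: "X \<subseteq> V \<times> V"
    using sp by (auto simp: spread_above_def)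
  have "real (card UU) \<le> real (card V) ^ Suc t * real (card D)"
    using of_nat_mono[OF big, where 'a = real] by (simp add: mult.commute mult.left_commute)
  also have "\<dots> \<le> real (card V) ^ Suc t * (r ^ card X * real (card (?G X)))"
    using cX by (intro mult_left_mono) auto
  also have "\<dots> \<le> real (card V) ^ Suc t * (r ^ card X * real (card (containing X)))"
    using GX(2) \<open>0 < r\<close> finite_subset[OF containing_subset finite_family]
    by (intro mult_left_mono) (auto intro: card_mono)
  finally have "card X \<le> ?m"
    using GX by (intro card_le_if_not_small[OF XV _ _ r]) auto
  moreover have "?G X \<subseteq> F" by (auto simp: D_def)
  ultimately have "X \<in> cores r ?m F" using sp XV unfolding cores_def by blast
  then have "?G X \<inter> containing X = {}" by (auto simp: D_def)
  then show False using GX by blast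
qed

text \<open>Without extra common pairs, a common \<open>t\<close>-set \<open>K\<close> of
  \<open>U\<close> and \<open>U0\<close> must be \<open>T\<close> itself, which would put
  \<open>U0\<close> into the star.\<close>

lemma missing_from_star:
  assumes F: "\<And>U U'. U \<in> F \<Longrightarrow> U' \<in> F \<Longrightarrow> \<exists>A\<in>U. \<exists>B\<in>U'. t \<le> card (A \<inter> B)" and FU: "F \<subseteq> UU"
    and T: "T \<subseteq> V" "card T = t" "2 \<le> t" and U0: "U0 \<in> F" "U0 \<notin> star T"
  shows "F \<inter> {U\<in>star T. extra_common T U0 U = {}} = {}"
proof (rule ccontr)
  assume "\<not> ?thesis"
  then obtain U where U: "U \<in> F" "U \<in> star T" "extra_common T U0 U = {}" by auto
  obtain A B where AB: "A \<in> U" "B \<in> U0" "t \<le> card (A \<inter> B)" using F[OF U(1) U0(1)] by auto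
  have "U \<in> UU" using U FU by auto
  from exists_off_diagonal_set[OF this AB] obtain K where K: "card K = t" "K \<times> K - Id \<subseteq> part_pairs U \<inter> part_pairs U0"
    by (auto simp: off_diagonal_sets_def)
  have "K \<times> K - Id \<subseteq> T \<times> T" using K(2) U(3) by (auto simp: extra_common_def)
  then have "K \<subseteq> T" using off_diagonal_subset K(1) T(3) by metis
  then have "K = T" using T K fin_ground by (metis card_subset_eq finite_subset)
  then have "U0 \<in> star T" using K U0 FU by (auto simp: containing_def)
  then show False using U0 by simp
qed

text \<open>Fix \<open>X1\<close> in \<open>C\<close>. Any \<open>X\<close> in \<open>C\<close>
  shares some \<open>T\<close> with \<open>X1\<close>, and some \<open>T'\<close> with the element
  \<open>Z T\<close> of \<open>C\<close> that misses \<open>T\<close>; so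
  \<open>T \<noteq> T'\<close> and \<open>containing X\<close> lies in two distinct stars. At most
  \<open>2 ^ m * 2 ^ m\<close> such pairs arise, each with at most \<open>2 * k * c / card V\<close>
  common members.\<close>

lemma card_without_common_set:
  assumes t: "2 \<le> t" and N: "2 * (t + 1) \<le> card V" and fX: "\<And>X. X \<in> C \<Longrightarrow> finite X \<and> card X \<le> m"
    and meet: "\<And>X X'. X \<in> C \<Longrightarrow> X' \<in> C \<Longrightarrow> off_diagonal_sets t X \<inter> off_diagonal_sets t X' \<noteq> {}"
    and no: "\<And>T. \<exists>X\<in>C. T \<notin> off_diagonal_sets t X"
    and c: "\<And>T. T \<subseteq> V \<Longrightarrow> card T = t \<Longrightarrow> card (star T) \<le> c"
  shows "card (\<Union>X\<in>C. containing X) * card V \<le> 4 ^ m * (2 * k * c)"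
proof -
  let ?S = "off_diagonal_sets t"
  obtain X1 where X1: "X1 \<in> C" using no by auto
  obtain Z where Z: "\<And>T. Z T \<in> C" "\<And>T. T \<notin> ?S (Z T)" using no by metis
  have fS: "finite (?S X)" "card (?S X) \<le> 2 ^ m" if "X \<in> C" for X
    using card_off_diagonal_sets_le[OF t, of X m] fX[OF that] by auto
  let ?B = "\<lambda>T T'. star T \<inter> star T'"
  have Bc: "card (?B T T') * card V \<le> 2 * k * c" if "T \<in> ?S X1" "T' \<in> ?S (Z T)" for T T'
  proof -
    have T: "T \<subseteq> V" "T' \<subseteq> V" "card T = t" "card T' = t" using that by (auto simp: off_diagonal_sets_def)
    have "T \<noteq> T'" using that Z by auto
    have "card V \<le> 2 * (card V - t - 1)" using N by arith
    then have "card (?B T T') * card V \<le> card (?B T T') * (2 * (card V - t - 1))" by (rule mult_left_mono) simp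
    also have "\<dots> = 2 * (card (?B T T') * (card V - t - 1))" by simp
    also have "\<dots> \<le> 2 * (k * card (star T))"
      using card_two_stars_le[OF T t \<open>T \<noteq> T'\<close>] by (rule mult_left_mono) simp
    also have "\<dots> \<le> 2 * (k * c)" using c[OF T(1,3)] by simp
    finally show ?thesis by simp
  qed
  have "(\<Union>X\<in>C. containing X) \<subseteq> (\<Union>T\<in>?S X1. \<Union>T'\<in>?S (Z T). ?B T T')"
  proof
    fix U assume "U \<in> (\<Union>X\<in>C. containing X)"
    then obtain X where X: "X \<in> C" "U \<in> containing X" by auto
    obtain T where T: "T \<in> ?S X1" "T \<in> ?S X" using meet[OF X1 X(1)] by auto
    obtain T' where T': "T' \<in> ?S (Z T)" "T' \<in> ?S X" using meet[OF Z(1)[of T] X(1)] by auto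
    have "U \<in> ?B T T'" using X T T' by (auto simp: off_diagonal_sets_def containing_def)
    then show "U \<in> (\<Union>T\<in>?S X1. \<Union>T'\<in>?S (Z T). ?B T T')" using T T' by blast
  qed
  then have "card (\<Union>X\<in>C. containing X) \<le> card (\<Union>T\<in>?S X1. \<Union>T'\<in>?S (Z T). ?B T T')"
    using fS(1) X1 Z(1) finite_star by (intro card_mono) auto
  also have "\<dots> \<le> (\<Sum>T\<in>?S X1. card (\<Union>T'\<in>?S (Z T). ?B T T'))"
    using fS(1) X1 by (intro card_UN_le) auto
  also have "\<dots> \<le> (\<Sum>T\<in>?S X1. \<Sum>T'\<in>?S (Z T). card (?B T T'))"
    using fS(1) Z(1) by (intro sum_mono card_UN_le) auto
  finally have "card (\<Union>X\<in>C. containing X) * card V \<le> (\<Sum>T\<in>?S X1. \<Sum>T'\<in>?S (Z T). card (?B T T')) * card V"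
    by (rule mult_right_mono) simp
  also have "\<dots> = (\<Sum>T\<in>?S X1. \<Sum>T'\<in>?S (Z T). card (?B T T') * card V)"
    by (simp add: sum_distrib_right)
  also have "\<dots> \<le> (\<Sum>T\<in>?S X1. \<Sum>T'\<in>?S (Z T). 2 * k * c)" by (intro sum_mono Bc)
  also have "\<dots> \<le> (\<Sum>T\<in>?S X1. 2 ^ m * (2 * k * c))"
    using fS(2)[OF Z(1)] by (intro sum_mono) (simp add: mult_right_mono)
  also have "\<dots> = card (?S X1) * (2 ^ m * (2 * k * c))" by simp
  also have "\<dots> \<le> 2 ^ m * (2 ^ m * (2 * k * c))" using fS(2)[OF X1] by (rule mult_right_mono) simp
  also have "\<dots> = 4 ^ m * (2 * k * c)" by (simp add: power_mult_distrib[symmetric] flip: mult.assoc)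
  finally show ?thesis .
qed

text \<open>Maximality of \<open>F\<close> enters in the form \<open>c\<close>. The number
  \<open>b\<close> is the scale of the argument: \<open>card V\<close>, the spreadness and the sizes
  of the pair sets are compared as powers of it.\<close>

lemma large_intersecting_subset_star:
  assumes t: "2 \<le> t" and part: "\<And>U. U \<in> UU \<Longrightarrow> \<exists>A\<in>U. t \<le> card A" and ne: "UU \<noteq> {}"
    and FU: "F \<subseteq> UU"
    and F: "\<And>U U'. U \<in> F \<Longrightarrow> U' \<in> F \<Longrightarrow> \<exists>A\<in>U. \<exists>B\<in>U'. t \<le> card (A \<inter> B)"
    and c: "\<And>T. T \<subseteq> V \<Longrightarrow> card T = t \<Longrightarrow> card (star T) \<le> card F"
    and b: "real (card V) = b ^ (64 * k)" "6 * real (128 * k + 1) < b" "2 * real (4 * k * (2 * t + 3)) \<le> b"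
    and N: "2 * (t + 1 + k + 2 * k * k) \<le> card V" "2 * (1 + 2 * k * k) ^ (4 * k * k) \<le> card V"
      "4 ^ (4 * k * (2 * t + 3)) * (2 * k) + 1 \<le> card V"
  shows "\<exists>T. T \<subseteq> V \<and> card T = t \<and> F \<subseteq> star T"
proof -
  let ?m = "4 * k * (2 * t + 3)" and ?h = "128 * k + 1" and ?N = "card V"
  \<comment> \<open>The exponent \<open>4\<close> gives \<open>card V = r ^ (16 * k)\<close>, as the
    bound on core sizes requires, and leaves a spare \<open>b\<^sup>2\<close> to absorb the factor
    \<open>4 * ?h\<close>.\<close>
  define r where "r = b ^ 4"
  define C where "C = cores r ?m F"
  define D where "D = F - (\<Union>X\<in>C. containing X)"
  have b1: "3 \<le> b" "1 < b" using b(2) by auto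
  have br: "b \<le> r" using b1 power_increasing[of 1 4 b] by (simp add: r_def)
  have rV: "real ?N = r ^ (16 * k)" using b(1) by (simp add: r_def flip: power_mult)
  have r1: "1 < r" "2 * real k \<le> r" "2 * real ?m \<le> r" using br b1 b(2,3) by auto
  have R: "4 * real ?h * b\<^sup>2 \<le> r"
  proof -
    have "4 * real ?h \<le> b" using b(2) by simp
    also have "b \<le> b\<^sup>2" using b1 by (simp add: power2_eq_square)
    finally have "4 * real ?h * b\<^sup>2 \<le> b\<^sup>2 * b\<^sup>2" by (rule mult_right_mono) simp
    then show ?thesis by (simp add: r_def flip: power_add)
  qed
  \<comment> \<open>Pair sets have at most \<open>k * card V\<close> elements, hence at most
    \<open>b ^ (128 * k)\<close>; the extra \<open>1\<close> in \<open>?h\<close> makes the bound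
    strict.\<close>
  have size: "real (k * ?N) < b ^ ?h"
  proof -
    have "k \<le> ?N" using N(1) by simp
    then have "real (k * ?N) \<le> real ?N * real ?N" by (simp add: mult_right_mono)
    also have "\<dots> = b ^ (128 * k)" unfolding b(1) by (simp flip: power_add)
    also have "\<dots> < b ^ ?h" using b1 by (intro power_strict_increasing) auto
    finally show ?thesis .
  qed
  have meet: "off_diagonal_sets t X \<inter> off_diagonal_sets t X' \<noteq> {}" if "X \<in> C" "X' \<in> C" for X X'
    by (rule cores_meet[OF F FU _ _ r1(3) b(2) b1(1) _ R size]) (use that in \<open>auto simp: C_def\<close>)
  have fF: "finite F" using FU finite_family finite_subset by blast
  have "k \<le> ?N" using N(1) by simp
  then have N0: "0 < ?N" using k_pos by linarith
  \<comment> \<open>Members without a core are few relative to \<open>UU\<close>; covering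
    \<open>UU\<close> by stars costs only \<open>?N ^ t\<close>, which leaves \<open>D\<close>
    smaller than \<open>F\<close> by a factor \<open>?N\<close>.\<close>
  have "card D * ?N ^ Suc t < card UU"
    unfolding D_def C_def by (rule card_outside_cores[OF FU ne r1(1,2) rV])
  also have "\<dots> \<le> ?N ^ t * card F" by (rule card_family_le[OF _ part c]) (use t in simp_all)
  finally have "?N ^ t * (card D * ?N) < ?N ^ t * card F" by (simp add: mult.commute mult.left_commute)
  then have DN: "card D * ?N < card F" using N0 by simp
  show ?thesis
  proof (cases "\<exists>T. \<forall>X\<in>C. T \<in> off_diagonal_sets t X")
    case False
    have fX: "finite X \<and> card X \<le> ?m" if "X \<in> C" for X
      using that fin_ground by (auto simp: C_def cores_def intro: finite_subset)
    have "2 * (t + 1) \<le> ?N" using N(1) by simp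
    then have "card (\<Union>X\<in>C. containing X) * ?N \<le> 4 ^ ?m * (2 * k * card F)"
      using False by (intro card_without_common_set[OF t _ fX meet _ c]) auto
    moreover have "F \<subseteq> (\<Union>X\<in>C. containing X) \<union> D" by (auto simp: D_def)
    then have "card F \<le> card ((\<Union>X\<in>C. containing X) \<union> D)"
      using fF containing_subset finite_family by (intro card_mono) (auto simp: D_def intro: finite_subset)
    then have "card F \<le> card (\<Union>X\<in>C. containing X) + card D" using card_Un_le le_trans by blast
    then have "card F * ?N \<le> card (\<Union>X\<in>C. containing X) * ?N + card D * ?N"
      by (metis add_mult_distrib mult_le_mono1)
    ultimately have "card F * ?N < (4 ^ ?m * (2 * k) + 1) * card F" using DN by (simp add: algebra_simps)
    also have "\<dots> \<le> ?N * card F" using N(3) by (rule mult_right_mono) simp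
    finally show ?thesis by simp
  next
    case True
    then obtain T where T: "\<And>X. X \<in> C \<Longrightarrow> T \<in> off_diagonal_sets t X" by auto
    \<comment> \<open>Only the existence of a core makes \<open>T\<close> a genuine
      \<open>t\<close>-subset of \<open>V\<close>; without cores \<open>D\<close> would be all of
      \<open>F\<close>.\<close>
    have "C \<noteq> {}"
    proof
      assume "C = {}"
      then have "D = F" by (simp add: D_def)
      then have "card F * ?N < card F * 1" using DN by simp
      then show False using N0 by (simp only: mult_less_cancel1) simp
    qed
    then have TV: "T \<subseteq> V" "card T = t" using T by (auto simp: off_diagonal_sets_def)
    have FD: "F \<subseteq> star T \<union> D"
      using T by (fastforce simp: D_def off_diagonal_sets_def containing_def)
    have "F \<subseteq> star T"
    proof (rule ccontr)
      assume "\<not> F \<subseteq> star T"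
      then obtain U0 where U0: "U0 \<in> F" "U0 \<notin> star T" by auto
      let ?M = "{U\<in>star T. extra_common T U0 U = {}}"
      let ?K = "2 * (1 + 2 * k * k) ^ (4 * k * k)"
      have "F \<inter> ?M = {}" by (rule missing_from_star[OF F FU TV t U0])
      then have "F \<subseteq> (star T - ?M) \<union> D" using FD by blast
      then have "card F \<le> card ((star T - ?M) \<union> D)"
        using finite_star fF by (intro card_mono) (auto simp: D_def)
      also have "\<dots> \<le> card (star T - ?M) + card D" by (rule card_Un_le)
      also have "card (star T - ?M) = card (star T) - card ?M"
        using finite_star by (intro card_Diff_subset) auto
      finally have 1: "card F \<le> card (star T) - card ?M + card D" .
      have 2: "card ?M \<le> card (star T)" using finite_star by (intro card_mono) auto
      have 3: "card (star T) \<le> card F" by (rule c[OF TV])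
      have 4: "card (star T) \<le> ?K * card ?M"
        using card_star_le_no_extra_common[OF _ TV(1)] U0(1) FU N(1) TV(2) by auto
      \<comment> \<open>The star is no larger than \<open>F\<close>, so the members of
        \<open>F\<close> outside it, all in \<open>D\<close>, must make up for the excluded
        \<open>?M\<close>.\<close>
      have MD: "card ?M \<le> card D" using 1 2 3 by linarith
      have "?K \<noteq> 0" by simp
      \<comment> \<open>Removing \<open>?M\<close> from the star takes away one of the
        \<open>?K\<close> copies of \<open>card ?M\<close> that bound it. This yields
        \<open>card F \<le> ?K * card D\<close>, which is too small.\<close>
      then obtain K where K: "?K = Suc K" by (metis not0_implies_Suc)
      have "card F \<le> K * card ?M + card D" using 1 4 unfolding K by simp
      also have "\<dots> \<le> ?K * card D" using MD unfolding K by simp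
      also have "\<dots> \<le> ?N * card D" using N(2) by (rule mult_right_mono) simp
      finally show False using DN by (simp add: mult.commute)
    qed
    then show ?thesis using TV by blast
  qed
qed

end

section \<open>Partitions with a given profile\<close>

lemma card_le_of_mem_profile_partition:
  assumes P: "profile P" "P \<noteq> []" "last P = k" and U: "U \<in> profile_partitions P" and A: "A \<in> U"
  shows "card A \<le> k"
proof -
  have "finite U"
    using U finite_elements[of "{1..sum_list P}"] by (auto simp: profile_partitions_def)
  then have "card A \<in># image_mset card (mset_set U)" using A by auto
  also have "image_mset card (mset_set U) = mset P" using U by (simp add: profile_partitions_def)
  finally have "card A \<in> set P" by simp
  then obtain i where "i < length P" "card A = P ! i" by (auto simp: in_set_conv_nth)
  then show ?thesis
    using P by (auto simp: profile_def last_conv_nth intro!: sorted_nth_mono)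
qed

lemma exists_largest_part:
  assumes "P \<noteq> []" "U \<in> profile_partitions P"
  shows "\<exists>A\<in>U. card A = last P"
proof -
  have "last P \<in># image_mset card (mset_set U)" using assms by (simp add: profile_partitions_def)
  moreover have "finite U"
    using assms(2) finite_elements[of "{1..sum_list P}"] by (auto simp: profile_partitions_def)
  ultimately show ?thesis by auto
qed

lemma length_le_sum_list_profile: "profile P \<Longrightarrow> length P \<le> sum_list P"
proof -
  assume "profile P"
  then have "\<forall>x\<in>set P. 1 \<le> x" by (auto simp: profile_def)
  then show ?thesis by (induction P) auto
qed

lemma swap_points_profile_partition:
  assumes U: "U \<in> profile_partitions P" and xy: "x \<in> {1..sum_list P}" "y \<in> {1..sum_list P}"
  shows "swap_points x y U \<in> profile_partitions P"
proof -
  let ?V = "{1..sum_list P}" and ?\<tau> = "transpose x y"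
  have part: "partition_on ?V U" and cards: "image_mset card (mset_set U) = mset P"
    using U by (auto simp: profile_partitions_def)
  have inj: "inj ?\<tau>" by (rule inj_transpose)
  have "?\<tau> ` ?V = ?V" using xy by (auto simp: transpose_image_eq)
  moreover have "{} \<notin> (`) ?\<tau> ` U" using partition_onD3[OF part] by auto
  ultimately have "partition_on ?V (swap_points x y U)"
    using partition_on_inj_image[OF part inj_on_subset[OF inj subset_UNIV]]
    by (simp add: swap_points_def)
  moreover have "image_mset card (mset_set (swap_points x y U)) = mset P"
  proof -
    have "inj_on ((`) ?\<tau>) U" by (rule inj_onI) (simp add: inj_image_eq_iff[OF inj])
    then have "mset_set (swap_points x y U) = image_mset ((`) ?\<tau>) (mset_set U)"
      by (simp add: swap_points_def image_mset_mset_set)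
    then have "image_mset card (mset_set (swap_points x y U)) = image_mset (\<lambda>A. card (?\<tau> ` A)) (mset_set U)"
      by (simp add: multiset.map_comp comp_def)
    also have "(\<lambda>A. card (?\<tau> ` A)) = card"
      using card_image[OF inj_on_subset[OF inj subset_UNIV]] by (intro ext)
    finally show ?thesis using cards by simp
  qed
  ultimately show ?thesis by (simp add: profile_partitions_def)
qed

lemma partition_family_profile_partitions:
  assumes "profile P" "P \<noteq> []" "last P = k" "0 < k"
  shows "partition_family {1..sum_list P} k (profile_partitions P)"
  using assms card_le_of_mem_profile_partition swap_points_profile_partition
  by unfold_locales (auto simp: profile_partitions_def)

lemma canonical_family_intersecting:
  assumes "T \<subseteq> {1..sum_list P}"
  shows "canonical_family P T \<subseteq> profile_partitions P"
    "partially_intersecting (card T) (canonical_family P T)"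
proof -
  show "canonical_family P T \<subseteq> profile_partitions P" by (auto simp: canonical_family_def)
  have "card T \<le> card (A \<inter> B)" if "U \<in> profile_partitions P" "A \<in> U" "T \<subseteq> A" "T \<subseteq> B" for U A B
  proof -
    have "A \<subseteq> {1..sum_list P}" using that partition_onD1 by (fastforce simp: profile_partitions_def)
    then have "finite A" by (rule finite_subset) simp
    then show ?thesis using that by (intro card_mono) auto
  qed
  then show "partially_intersecting (card T) (canonical_family P T)"
    unfolding partially_intersecting_def partially_intersect_def canonical_family_def by blast
qed

section \<open>Largest intersecting families for a profile\<close>

lemma finite_profile_partitions: "finite (profile_partitions P)"
  by (rule finite_subset[OF _ finitely_many_partition_on[of "{1..sum_list P}"]])
    (auto simp: profile_partitions_def)

text \<open>Every partition covers the point \<open>1\<close>, so its canonical family is the whole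
  of \<open>profile_partitions P\<close>.\<close>

lemma largest_1_intersecting:
  assumes P: "profile P" "P \<noteq> []" and F: "largest_partially_intersecting 1 P F"
  shows "F = canonical_family P {1}"
proof -
  have "1 \<le> sum_list P" using length_le_sum_list_profile[OF P(1)] P(2) by (cases P) auto
  have "1 \<in> \<Union>U" if "U \<in> profile_partitions P" for U
  proof -
    have "{1..sum_list P} = \<Union>U"
      using that by (intro partition_onD1) (simp add: profile_partitions_def)
    moreover have "1 \<in> {1..sum_list P}" using \<open>1 \<le> sum_list P\<close> by simp
    ultimately show ?thesis by (rule subst)
  qed
  then have "canonical_family P {1} = profile_partitions P"
    by (auto simp: canonical_family_def)
  moreover have "partially_intersecting 1 (canonical_family P {1})"
    using canonical_family_intersecting(2)[of "{1}" P] \<open>1 \<le> sum_list P\<close> by simp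
  ultimately show ?thesis
    using F finite_profile_partitions unfolding largest_partially_intersecting_def
    by (metis card_seteq order_refl)
qed

text \<open>Canonical families are intersecting, so by maximality no star exceeds \<open>F\<close>;
  containment of \<open>F\<close> in a star then becomes equality.\<close>

lemma largest_partially_intersecting_canonical:
  assumes P: "profile P" "P \<noteq> []" "last P = k" and t: "2 \<le> t" "t \<le> k"
    and F: "largest_partially_intersecting t P F"
    and b: "real (sum_list P) = b ^ (64 * k)" "6 * real (128 * k + 1) < b" "2 * real (4 * k * (2 * t + 3)) \<le> b"
    and N: "2 * (t + 1 + k + 2 * k * k) \<le> sum_list P" "2 * (1 + 2 * k * k) ^ (4 * k * k) \<le> sum_list P"
      "4 ^ (4 * k * (2 * t + 3)) * (2 * k) + 1 \<le> sum_list P"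
  shows "\<exists>T. T \<subseteq> {1..sum_list P} \<and> card T = t \<and> F = canonical_family P T"
proof -
  let ?V = "{1..sum_list P}" and ?UU = "profile_partitions P"
  have "0 < k" using t by simp
  then interpret partition_family ?V k ?UU using P by (intro partition_family_profile_partitions)
  have FU: "F \<subseteq> ?UU" and int: "partially_intersecting t F"
    and max: "\<And>G. G \<subseteq> ?UU \<Longrightarrow> partially_intersecting t G \<Longrightarrow> card G \<le> card F"
    using F by (auto simp: largest_partially_intersecting_def)
  have star: "star T = canonical_family P T" if "T \<subseteq> ?V" "card T = t" for T
  proof -
    have "T \<noteq> {}" using that t by auto
    then show ?thesis
      using offdiag_subset_part_pairs_iff[of ?V _ T] partition that(1)
      by (auto simp: containing_def canonical_family_def)
  qed
  have c: "card (star T) \<le> card F" if "T \<subseteq> ?V" "card T = t" for T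
    using star[OF that] canonical_family_intersecting[OF that(1)] that(2) max by auto
  have "\<exists>T. T \<subseteq> ?V \<and> card T = t \<and> F \<subseteq> star T"
  proof (cases "?UU = {}")
    \<comment> \<open>With no partitions at all, \<open>F\<close> is empty and any
      \<open>t\<close>-set serves.\<close>
    case True
    have "t \<le> card ?V" using N(1) by simp
    then obtain T where "T \<subseteq> ?V" "card T = t" by (metis obtain_subset_with_card_n)
    then show ?thesis using FU True by auto
  next
    case False
    have part: "\<exists>A\<in>U. t \<le> card A" if "U \<in> ?UU" for U
      using exists_largest_part[OF P(2) that] P(3) t(2) by metis
    have int': "\<exists>A\<in>U. \<exists>B\<in>U'. t \<le> card (A \<inter> B)" if "U \<in> F" "U' \<in> F" for U U'
      using int that by (auto simp: partially_intersecting_def partially_intersect_def)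
    show ?thesis
      using b N by (intro large_intersecting_subset_star[OF t(1) part False FU int' c, where b = b]) auto
  qed
  then obtain T where T: "T \<subseteq> ?V" "card T = t" "F \<subseteq> star T" by auto
  then have "F = star T" using c[OF T(1,2)] finite_star by (metis card_seteq)
  with star T show ?thesis by auto
qed

theorem theorem9:
  fixes k t :: nat
  assumes "0 < t" and "t \<le> k"
  shows "\<exists>l0::nat. \<forall>l\<ge>l0. \<forall>P::nat list.
           profile P \<and> length P = l \<and> P \<noteq> [] \<and> last P = k \<longrightarrow>
           (\<forall>F. largest_partially_intersecting t P F \<longrightarrow>
              (\<exists>T. T \<subseteq> {1..sum_list P} \<and> card T = t \<and> F = canonical_family P T))"
proof (cases "t = 1")
  case True
  have "{1} \<subseteq> {1..sum_list P}" if "profile P" "P \<noteq> []" for P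
    using length_le_sum_list_profile[OF that(1)] that(2) by (cases P) auto
  then show ?thesis using True largest_1_intersecting
    by (intro exI[of _ 0] allI impI) (metis is_singletonI is_singleton_altdef)
next
  case False
  with assms have t: "2 \<le> t" and k: "0 < k" by auto
  \<comment> \<open>\<open>B\<close> exceeds both lower bounds wanted for the root
    \<open>?b\<close>. The other summands of \<open>l0\<close> are the conditions on the size of the
    ground set, which is at least the number of parts.\<close>
  define B where "B = 6 * (128 * k + 1) + 2 * (4 * k * (2 * t + 3)) + 1"
  define l0 where "l0 = B ^ (64 * k) + 2 * (t + 1 + k + 2 * k * k) + 2 * (1 + 2 * k * k) ^ (4 * k * k)
    + (4 ^ (4 * k * (2 * t + 3)) * (2 * k) + 1)"
  show ?thesis
  proof (intro exI[of _ l0] allI impI)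
    fix l P F
    assume l: "l0 \<le> l" and P: "profile P \<and> length P = l \<and> P \<noteq> [] \<and> last P = k"
      and F: "largest_partially_intersecting t P F"
    have n: "l0 \<le> sum_list P" using l P length_le_sum_list_profile[of P] by auto
    \<comment> \<open>A real root makes the size of the ground set an exact power, without
      rounding.\<close>
    let ?b = "root (64 * k) (real (sum_list P))"
    have b: "real (sum_list P) = ?b ^ (64 * k)" using k by simp
    have "B ^ (64 * k) \<le> sum_list P" using n by (simp add: l0_def)
    then have "real B ^ (64 * k) \<le> real (sum_list P)" by (metis of_nat_le_iff of_nat_power)
    then have "root (64 * k) (real B ^ (64 * k)) \<le> ?b" using k by (intro real_root_le_mono) auto
    then have "real B \<le> ?b" using k by (simp add: real_root_power_cancel)
    moreover have "real (6 * (128 * k + 1)) < real B" "real (2 * (4 * k * (2 * t + 3))) \<le> real B"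
      unfolding of_nat_less_iff of_nat_le_iff by (simp_all add: B_def)
    ultimately have b': "6 * real (128 * k + 1) < ?b" "2 * real (4 * k * (2 * t + 3)) \<le> ?b"
      unfolding of_nat_mult[of 6] of_nat_mult[of 2] of_nat_numeral by linarith+
    show "\<exists>T. T \<subseteq> {1..sum_list P} \<and> card T = t \<and> F = canonical_family P T"
      by (rule largest_partially_intersecting_canonical[OF _ _ _ t assms(2) F b b'])
        (use P n in \<open>auto simp: l0_def\<close>)
  qed
qed

end
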